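(* Let $\Bbbk$ be a field and let $X$ be an $L$-convex polyomino that is not thin. Let $h(t) = 1 + h_1 t + h_2 t^2 + \cdots$ be the $h$-polynomial of $\Bbbk[X]$ and let $r(t) = 1 + r_1 t + r_2 t^2 + \cdots$ be the rook polynomial of $X$. Then $h_2 < r_2$.
   Context: A cell in $\mathbb{R}^2$ is a set $\{(x,y)\in\mathbb{R}^2 \mid a\le x\le a+1,\ b\le y\le b+1\}$ with $(a,b)\in\mathbb{Z}^2$. A polyomino $X$ is a finite union of cells that is connected and has no finite cut-set (removing any finite set of points from $X$ leaves it connected). $X$ is horizontally (respectively vertically) convex if every line segment parallel to the $x$-axis (respectively $y$-axis) with end-points in $X$ is contained in $X$; $X$ is convex if it is both horizontally and vertically convex. $X$ is $L$-convex if it is convex and any two cells of $X$ can be joined by a path of cells of $X$ (consecutive cells sharing an edge) that is monotone (uses only two of the four step directions, at most one horizontal and one vertical) and has at most one change of direction. The vertex set of $X$ is $V(X)=X\cap\mathbb{Z}^2$. $\mathbb{N}$ denotes the nonnegative integers. $\mathbb{R}^2$ carries the componentwise partial order: $(a_1,a_2)\le(b_1,b_2)$ iff $a_1\le b_1$ and $a_2\le b_2$. $X$ is thin if it does not contain a $2\times 2$ square of four cells. For a convex polyomino $X$, let $R=\Bbbk[x_v \mid v\in V(X)]$ be the polynomial ring, and let $I_X$ be the ideal of $R$ generated by the binomials $x_ax_b-x_cx_d$ where $a\le b$ are in $V(X)$ and $c,d\in V(X)$ are the other two corners of the rectangle with bottom-left corner $a$ and top-right corner $b$ (only those pairs $a\le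 b$ for which both other corners lie in $V(X)$ are used). Set $\Bbbk[X]=R/I_X$, with the standard grading ($\deg x_v=1$). The $h$-polynomial of a standard graded $\Bbbk$-algebra $A$ is the unique polynomial $h(t)\in\mathbb{Z}[t]$ such that the Hilbert series of $A$ is $h(t)/(1-t)^{d}$, where $d=\dim A$ is the Krull dimension. For $k\in\mathbb{N}$, a $k$-rook configuration in $X$ is an arrangement of $k$ (indistinguishable) rooks on distinct cells of $X$ in pairwise non-attacking positions; for convex $X$ this is a set of $k$ cells of $X$, no two of which lie in the same row or the same column. Let $r_k$ be the number of $k$-rook configurations in $X$. The rook polynomial of $X$ is $r(t)=\sum_{k\in\mathbb{N}} r_kt^k$. *)

theory Defs
  imports
    "HOL-Analysis.Analysis"
    "HOL-Library.Poly_Mapping"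
    "HOL-Library.Extended_Nat"
    "HOL-Computational_Algebra.Polynomial_FPS"
    "HOL-Algebra.QuotRing"
    "HOL-Algebra.Embedded_Algebras"
begin

section \<open>Polyominoes\<close>

definition lattice_point :: "int \<times> int \<Rightarrow> real \<times> real" where
  "lattice_point v = (real_of_int (fst v), real_of_int (snd v))"

text \<open>Cells are indexed by their bottom-left corners.\<close>

definition cell :: "int \<times> int \<Rightarrow> (real \<times> real) set" where
  "cell c = {(x, y). real_of_int (fst c) \<le> x \<and> x \<le> real_of_int (fst c) + 1 \<and>
                     real_of_int (snd c) \<le> y \<and> y \<le> real_of_int (snd c) + 1}"

definition polyomino :: "(real \<times> real) set \<Rightarrow> bool" where
  "polyomino X \<longleftrightarrow>
     (\<exists>S. finite S \<and> X = (\<Union>c\<in>S. cell c)) \<and>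
     connected X \<and>
     (\<forall>F. finite F \<and> F \<subseteq> X \<longrightarrow> connected (X - F))"

definition cells :: "(real \<times> real) set \<Rightarrow> (int \<times> int) set" where
  "cells X = {c. cell c \<subseteq> X}"

definition vertex_set :: "(real \<times> real) set \<Rightarrow> (int \<times> int) set" where
  "vertex_set X = {v. lattice_point v \<in> X}"

definition horizontally_convex :: "(real \<times> real) set \<Rightarrow> bool" where
  "horizontally_convex X \<longleftrightarrow>
     (\<forall>x x' y. (x, y) \<in> X \<and> (x', y) \<in> X \<longrightarrow> closed_segment (x, y) (x', y) \<subseteq> X)"

definition vertically_convex :: "(real \<times> real) set \<Rightarrow> bool" where
  "vertically_convex X \<longleftrightarrow>
     (\<forall>x y y'. (x, y) \<in> X \<and> (x, y') \<in> X \<longrightarrow> closed_segment (x, y) (x, y') \<subseteq> X)"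

text \<open>Not to be confused with convexity as a subset of the plane.\<close>

definition convex_polyomino :: "(real \<times> real) set \<Rightarrow> bool" where
  "convex_polyomino X \<longleftrightarrow> polyomino X \<and> horizontally_convex X \<and> vertically_convex X"

text \<open>Two cells share an edge iff the difference of their indices is a unit step.\<close>

definition horizontal_steps :: "(int \<times> int) set" where
  "horizontal_steps = {(1, 0), (-1, 0)}"

definition vertical_steps :: "(int \<times> int) set" where
  "vertical_steps = {(0, 1), (0, -1)}"

definition path_step :: "(int \<times> int) list \<Rightarrow> nat \<Rightarrow> int \<times> int" where
  "path_step p i = p ! Suc i - p ! i"

definition cell_path :: "(real \<times> real) set \<Rightarrow> (int \<times> int) list \<Rightarrow> bool" where
  "cell_path X p \<longleftrightarrow>
     p \<noteq> [] \<and> set p \<subseteq> cells X \<and>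
     (\<forall>i. Suc i < length p \<longrightarrow> path_step p i \<in> horizontal_steps \<union> vertical_steps)"

definition monotone_path :: "(int \<times> int) list \<Rightarrow> bool" where
  "monotone_path p \<longleftrightarrow>
     (\<exists>s\<in>horizontal_steps. \<exists>t\<in>vertical_steps.
        \<forall>i. Suc i < length p \<longrightarrow> path_step p i \<in> {s, t})"

definition direction_changes :: "(int \<times> int) list \<Rightarrow> nat set" where
  "direction_changes p =
     {i. Suc (Suc i) < length p \<and> path_step p i \<noteq> path_step p (Suc i)}"

definition L_convex :: "(real \<times> real) set \<Rightarrow> bool" where
  "L_convex X \<longleftrightarrow>
     convex_polyomino X \<and>
     (\<forall>c\<in>cells X. \<forall>d\<in>cells X. \<exists>p.
        cell_path X p \<and> hd p = c \<and> last p = d \<and>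
        monotone_path p \<and> card (direction_changes p) \<le> 1)"

definition thin :: "(real \<times> real) set \<Rightarrow> bool" where
  "thin X \<longleftrightarrow>
     \<not> (\<exists>a b. {(a, b), (a + 1, b), (a, b + 1), (a + 1, b + 1)} \<subseteq> cells X)"


section \<open>The coordinate ring\<close>

text \<open>A monomial is a finitely supported exponent function, and a polynomial a finitely
  supported function from monomials to coefficients, multiplied by convolution. The library
  type has a variable for every point of the integer lattice; the carrier below consists of the
  polynomials that only involve the variables of the vertices of \<open>X\<close>.\<close>

type_synonym 'k mpolynomial = "((int \<times> int) \<Rightarrow>\<^sub>0 nat) \<Rightarrow>\<^sub>0 'k"

definition polynomial_ring :: "(real \<times> real) set \<Rightarrow> 'k::field mpolynomial ring" where
  "polynomial_ring X =
     \<lparr>carrier = {p. \<forall>m\<in>Poly_Mapping.keys p. Poly_Mapping.keys m \<subseteq> vertex_set X},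
      mult = (*), one = 1, zero = 0, add = (+)\<rparr>"

definition var :: "int \<times> int \<Rightarrow> 'k::field mpolynomial" where
  "var v = Poly_Mapping.single (Poly_Mapping.single v 1) 1"

definition const :: "'k \<Rightarrow> 'k::field mpolynomial" where
  "const a = Poly_Mapping.single 0 a"

text \<open>The order on \<open>int \<times> int\<close> is the componentwise one.\<close>

definition inner_binomials :: "(real \<times> real) set \<Rightarrow> 'k::field mpolynomial set" where
  "inner_binomials X =
     {var a * var b - var c * var d | a b c d.
        {a, b, c, d} \<subseteq> vertex_set X \<and> a \<le> b \<and> c = (fst a, snd b) \<and> d = (fst b, snd a)}"

definition polyomino_ideal :: "(real \<times> real) set \<Rightarrow> 'k::field mpolynomial set" where
  "polyomino_ideal X = Idl\<^bsub>polynomial_ring X\<^esub> (inner_binomials X)"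

definition coordinate_ring :: "(real \<times> real) set \<Rightarrow> 'k::field mpolynomial set ring" where
  "coordinate_ring X = polynomial_ring X Quot polyomino_ideal X"

definition residue_class :: "(real \<times> real) set \<Rightarrow> 'k::field mpolynomial \<Rightarrow> 'k mpolynomial set" where
  "residue_class X p = polyomino_ideal X +>\<^bsub>polynomial_ring X\<^esub> p"

definition scalars :: "(real \<times> real) set \<Rightarrow> 'k::field mpolynomial set set" where
  "scalars X = residue_class X ` range const"

definition monomial_degree :: "((int \<times> int) \<Rightarrow>\<^sub>0 nat) \<Rightarrow> nat" where
  "monomial_degree m = (\<Sum>v\<in>Poly_Mapping.keys m. Poly_Mapping.lookup m v)"

definition graded_piece :: "(real \<times> real) set \<Rightarrow> nat \<Rightarrow> 'k::field mpolynomial set set" where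
  "graded_piece X n =
     residue_class X ` {p \<in> carrier (polynomial_ring X).
                          \<forall>m\<in>Poly_Mapping.keys p. monomial_degree m = n}"


section \<open>Krull dimension and h-polynomial\<close>

definition prime_chain :: "('a, 'b) ring_scheme \<Rightarrow> nat \<Rightarrow> (nat \<Rightarrow> 'a set) \<Rightarrow> bool" where
  "prime_chain A n P \<longleftrightarrow>
     (\<forall>i\<le>n. primeideal (P i) A) \<and> (\<forall>i<n. P i \<subset> P (Suc i))"

definition krull_dim :: "('a, 'b) ring_scheme \<Rightarrow> enat" where
  "krull_dim A = Sup {enat n | n. \<exists>P. prime_chain A n P}"

definition hilbert_series ::
    "('a, 'b) ring_scheme \<Rightarrow> 'a set \<Rightarrow> (nat \<Rightarrow> 'a set) \<Rightarrow> int fps" where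
  "hilbert_series A K G = Abs_fps (\<lambda>n. int (ring.dim A K (G n)))"

text \<open>\<open>A\<close> is an algebra over its subfield \<open>K\<close>, with graded pieces \<open>G n\<close>. The equation states
  that the Hilbert series is $h(t)/(1-t)^d$, with the denominator cleared, which is harmless
  because $1-t$ is a unit in $\mathbb{Z}[[t]]$. It therefore has at most one solution.\<close>

definition h_polynomial_of ::
    "('a, 'b) ring_scheme \<Rightarrow> 'a set \<Rightarrow> (nat \<Rightarrow> 'a set) \<Rightarrow> int poly" where
  "h_polynomial_of A K G =
     (THE h. hilbert_series A K G * (1 - fps_X) ^ the_enat (krull_dim A) = fps_of_poly h)"

text \<open>The type argument carries the ground field.\<close>

definition h_polynomial :: "'k::field itself \<Rightarrow> (real \<times> real) set \<Rightarrow> int poly" where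
  "h_polynomial _ X =
     h_polynomial_of (coordinate_ring X :: 'k mpolynomial set ring) (scalars X) (graded_piece X)"


section \<open>Rook polynomial\<close>

text \<open>Cells in one row (column) of a convex polyomino are never separated by a gap, so rooks
  attack each other as soon as they share a row or a column. This does not apply to
  polyominoes that are not convex.\<close>

definition rook_configurations :: "(real \<times> real) set \<Rightarrow> nat \<Rightarrow> (int \<times> int) set set" where
  "rook_configurations X k =
     {S. S \<subseteq> cells X \<and> finite S \<and> card S = k \<and>
         (\<forall>c\<in>S. \<forall>d\<in>S. c \<noteq> d \<longrightarrow> fst c \<noteq> fst d \<and> snd c \<noteq> snd d)}"

text \<open>There are no configurations of more rooks than cells, so the sum is over all \<open>k\<close> that
  contribute.\<close>

definition rook_polynomial :: "(real \<times> real) set \<Rightarrow> int poly" where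
  "rook_polynomial X =
     (\<Sum>k\<le>card (cells X). Polynomial.monom (int (card (rook_configurations X k))) k)"

end

theory Submission
  imports Defs
begin

text \<open>Let \<open>n\<close> and \<open>c\<close> be the numbers of vertices and cells. L-convexity makes the vertex rows a
  chain under inclusion, and likewise the columns, so after permuting rows and columns the vertices
  form a Ferrers diagram. In it the monomials without a crossing pair of variables are a basis of
  the coordinate ring: crossings can be resolved with the binomials, and the remaining monomials are
  separated by the toric map \<open>x\<^sub>(\<^sub>a\<^sub>,\<^sub>b\<^sub>) \<mapsto> s\<^sub>a t\<^sub>b\<close>. Crossing pairs correspond to rectangles
  with vertices in \<open>X\<close>, so if the Krull dimension is \<open>d\<close> then \<open>h\<^sub>2 = (n - d + 1 choose 2) - r\<close> with
  \<open>r\<close> the number of rectangles. Only \<open>n - c \<le> d \<le> n\<close> is needed about \<open>d\<close>: it gives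
  \<open>h\<^sub>2 \<le> (c + 1 choose 2) - r\<close>, while \<open>r\<^sub>2 = (c choose 2)\<close> minus the number of attacking pairs
  of cells. Cells and attacking pairs of cells are rectangles of one row or one column, and a
  polyomino that is not thin has a further rectangle.\<close>

subsection \<open>Cells and vertices\<close>

text \<open>Put \<open>e = n - d\<close>. In degrees 0, 1, 2 the ring has dimensions
  \<open>1\<close>, \<open>n\<close> and \<open>(n + 1 choose 2) - r\<close>, so multiplying by
  \<open>(1 - t)\<^sup>d\<close> leaves \<open>(e + 1 choose 2) - r\<close> in degree 2. This grows
  with \<open>e\<close> once \<open>e\<close> is nonnegative, which is why an interval for
  \<open>d\<close> suffices: \<open>d \<le> n\<close> gives \<open>0 \<le> e\<close>, and
  \<open>n - c \<le> d\<close> gives \<open>e \<le> c\<close>. The lower bound on \<open>d\<close>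
  is the number of vertex rows plus the number of vertex columns minus 1, the length of an explicit
  chain of primes; a count of vertices against cells compares it with \<open>n - c\<close>. The same
  number bounds the support of a basis monomial, so the Hilbert series times
  \<open>(1 - t)\<^sup>d\<close> is a polynomial and the definite description in
  \<open>h_polynomial_of\<close> has a value. The generators of the ideal are tied to positions in
  the plane, so no vertex is moved: rank functions on columns and rows replace the permutations, and
  crossing refers to ranks. For the inequality it is enough to send rectangles injectively to
  crossing pairs.\<close>

lemma cell_centre_iff:
  "(real_of_int x + 1/2, real_of_int y + 1/2) \<in> cell c \<longleftrightarrow> c = (x, y)"
proof -
  have "real_of_int a \<le> real_of_int x + 1/2 \<and> real_of_int x + 1/2 \<le> real_of_int a + 1 \<longleftrightarrow> a = x" for a x :: int
    by linarith
  then show ?thesis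
    unfolding cell_def by (cases c) auto
qed

text \<open>Neighbouring cells overlap along edges, but the centre of a cell lies in no other cell,
  so a cell covered by the union must be one of its members.\<close>

lemma cells_Union:
  assumes "X = (\<Union>c\<in>S. cell c)"
  shows "cells X = S"
    and "(real_of_int x + 1/2, real_of_int y + 1/2) \<in> X \<longleftrightarrow> (x, y) \<in> S"
proof -
  show *: "(real_of_int x + 1/2, real_of_int y + 1/2) \<in> X \<longleftrightarrow> (x, y) \<in> S" for x y
    using assms cell_centre_iff by auto
  have "c \<in> S" if "cell c \<subseteq> X" for c
  proof -
    have "(real_of_int (fst c) + 1/2, real_of_int (snd c) + 1/2) \<in> cell c"
      by (simp add: cell_centre_iff)
    then show ?thesis using that *[of "fst c" "snd c"] by auto
  qed
  then show "cells X = S" using assms by (auto simp: cells_def)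
qed

text \<open>Midpoints detect edges as centres detect cells: they lie in exactly the two cells that
  share the edge.\<close>

lemma edge_midpoint_iff:
  shows "(real_of_int x + 1/2, real_of_int y) \<in> cell c \<longleftrightarrow> c = (x, y) \<or> c = (x, y - 1)"
    and "(real_of_int x, real_of_int y + 1/2) \<in> cell c \<longleftrightarrow> c = (x, y) \<or> c = (x - 1, y)"
proof -
  have 1: "real_of_int a \<le> real_of_int x + 1/2 \<and> real_of_int x + 1/2 \<le> real_of_int a + 1 \<longleftrightarrow> a = x" for a x :: int
    by linarith
  have 2: "real_of_int a \<le> real_of_int x \<and> real_of_int x \<le> real_of_int a + 1 \<longleftrightarrow> a = x \<or> a = x - 1" for a x :: int
    by linarith
  show "(real_of_int x + 1/2, real_of_int y) \<in> cell c \<longleftrightarrow> c = (x, y) \<or> c = (x, y - 1)"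
    unfolding cell_def using 1[of "fst c" x] 2[of "snd c" y] by (cases c) auto
  show "(real_of_int x, real_of_int y + 1/2) \<in> cell c \<longleftrightarrow> c = (x, y) \<or> c = (x - 1, y)"
    unfolding cell_def using 2[of "fst c" x] 1[of "snd c" y] by (cases c) auto
qed

lemma lattice_point_cell_iff:
  "lattice_point v \<in> cell c \<longleftrightarrow>
     (fst v = fst c \<or> fst v = fst c + 1) \<and> (snd v = snd c \<or> snd v = snd c + 1)"
proof -
  have 2: "real_of_int a \<le> real_of_int x \<and> real_of_int x \<le> real_of_int a + 1 \<longleftrightarrow> x = a \<or> x = a + 1" for a x :: int
    by linarith
  show ?thesis
    unfolding cell_def lattice_point_def using 2[of "fst c" "fst v"] 2[of "snd c" "snd v"] by auto
qed

lemma horizontal_segment_mem: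
  assumes "horizontally_convex X" "(a, y) \<in> X" "(b, y) \<in> X" "a \<le> t" "t \<le> b"
  shows "(t, y) \<in> X"
proof -
  define u where "u = (if a = b then 0 else (t - a) / (b - a))"
  have "0 \<le> u" "u \<le> 1" "t = (1 - u) * a + u * b"
    using assms by (auto simp: u_def field_simps)
  then have "(t, y) \<in> closed_segment (a, y) (b, y)"
    unfolding closed_segment_def by (auto intro!: exI[of _ u] simp: algebra_simps)
  then show ?thesis
    using assms unfolding horizontally_convex_def by blast
qed

lemma vertical_segment_mem:
  assumes "vertically_convex X" "(x, a) \<in> X" "(x, b) \<in> X" "a \<le> t" "t \<le> b"
  shows "(x, t) \<in> X"
proof -
  define u where "u = (if a = b then 0 else (t - a) / (b - a))"
  have "0 \<le> u" "u \<le> 1" "t = (1 - u) * a + u * b"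
    using assms by (auto simp: u_def field_simps)
  then have "(x, t) \<in> closed_segment (x, a) (x, b)"
    unfolding closed_segment_def by (auto intro!: exI[of _ u] simp: algebra_simps)
  then show ?thesis
    using assms unfolding vertically_convex_def by blast
qed

section \<open>Cell paths with at most one bend\<close>

lemma constant_steps:
  assumes "\<And>k. i \<le> k \<Longrightarrow> k < j \<Longrightarrow> path_step p k = s" "i \<le> j"
  shows "fst (p ! j) = fst (p ! i) + int (j - i) * fst s"
    and "snd (p ! j) = snd (p ! i) + int (j - i) * snd s"
proof -
  have "fst (p ! j) = fst (p ! i) + int (j - i) * fst s \<and> snd (p ! j) = snd (p ! i) + int (j - i) * snd s"
    using assms(2,1)
  proof (induction j rule: dec_induct)
    case base then show ?case by simp
  next
    case (step j)
    have "path_step p j = s" using step.prems step.hyps by auto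
    then have "p ! Suc j = p ! j + s" by (simp add: path_step_def algebra_simps)
    moreover have "int (Suc j - i) = int (j - i) + 1" using step.hyps by auto
    ultimately show ?case using step by (auto simp: algebra_simps)
  qed
  then show "fst (p ! j) = fst (p ! i) + int (j - i) * fst s"
    and "snd (p ! j) = snd (p ! i) + int (j - i) * snd s" by auto
qed

lemma no_change_constant:
  assumes "\<And>k. i \<le> k \<Longrightarrow> Suc k < j \<Longrightarrow> path_step p k = path_step p (Suc k)"
  shows "i \<le> k \<Longrightarrow> k < j \<Longrightarrow> path_step p k = path_step p i"
proof (induction k rule: dec_induct)
  case (step k) then show ?case using assms[of k] by auto
qed simp

text \<open>The path consists of two axis-parallel runs, so the cell at the bend is one of the two
  remaining corners of the box spanned by the end cells. This exchange property is all that is taken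
  from the paths.\<close>

lemma L_path_corner:
  assumes path: "cell_path X p" "monotone_path p" "card (direction_changes p) \<le> 1"
  shows "(fst (hd p), snd (last p)) \<in> cells X \<or> (fst (last p), snd (hd p)) \<in> cells X"
proof -
  define n where "n = length p - 1"
  have ne: "p \<noteq> []" and sub: "set p \<subseteq> cells X" using path by (auto simp: cell_path_def)
  then have len: "length p = Suc n" and hd: "hd p = p ! 0" and last: "last p = p ! n"
    by (auto simp: n_def hd_conv_nth last_conv_nth)
  obtain s t where s: "s \<in> horizontal_steps" and t: "t \<in> vertical_steps"
    and st: "\<And>i. i < n \<Longrightarrow> path_step p i \<in> {s, t}"
    using path(2) len unfolding monotone_path_def by auto
  have s0: "snd s = 0" and t0: "fst t = 0"
    using s t by (auto simp: horizontal_steps_def vertical_steps_def)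
  have fin: "finite (direction_changes p)"
    unfolding direction_changes_def by (rule finite_subset[of _ "{..<length p}"]) auto
  \<comment> \<open>\<open>m\<close> is the position of the bend: a change at index \<open>i\<close>
    compares steps \<open>i\<close> and \<open>Suc i\<close>, which meet at cell
    \<open>Suc i\<close>. Without a change the first run is the whole path.\<close>
  obtain m where m: "m \<le> n" "\<And>k. Suc k < m \<Longrightarrow> path_step p k = path_step p (Suc k)"
    "\<And>k. m \<le> k \<Longrightarrow> Suc k < n \<Longrightarrow> path_step p k = path_step p (Suc k)"
  proof (cases "direction_changes p = {}")
    case True
    then show ?thesis using that[of n] len unfolding direction_changes_def by auto
  next
    case False
    then have "card (direction_changes p) = 1" using path(3) fin
      by (metis One_nat_def card_0_eq le_antisym not_less_eq_eq bot_nat_0.extremum_unique)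
    then obtain i where i: "direction_changes p = {i}" by (auto simp: card_1_singleton_iff)
    then have *: "path_step p k = path_step p (Suc k)" if "Suc k < n" "k \<noteq> i" for k
      using that len unfolding direction_changes_def by auto
    have "Suc i < n" using i len unfolding direction_changes_def by auto
    then show ?thesis using that[of "Suc i"] * by auto
  qed
  have run: "fst (p ! j) = fst (p ! i) \<or> snd (p ! j) = snd (p ! i)"
    if ij: "i \<le> j" "j \<le> n" and c: "\<And>k. i \<le> k \<Longrightarrow> Suc k < j \<Longrightarrow> path_step p k = path_step p (Suc k)" for i j
  proof (cases "i = j")
    case False
    note cs = constant_steps[of i j p "path_step p i", OF no_change_constant[of i j p, OF c]]
    have "path_step p i \<in> {s, t}" using st ij False by auto
    then show ?thesis using cs ij s0 t0 by auto
  qed simp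
  have mem: "p ! i \<in> cells X" if "i \<le> n" for i using that len sub by auto
  have "fst (p ! m) = fst (p ! 0) \<or> snd (p ! m) = snd (p ! 0)" using run[of 0 m] m by auto
  moreover have "fst (p ! n) = fst (p ! m) \<or> snd (p ! n) = snd (p ! m)" using run[of m n] m by auto
  ultimately show ?thesis using mem[of 0] mem[of m] mem[of n] m(1) unfolding hd last
    by (metis le0 order_refl prod.collapse)
qed


section \<open>Vertices of a finite set of cells\<close>

definition corners :: "(int \<times> int) set \<Rightarrow> (int \<times> int) set" where
  "corners S = (\<Union>(x, y)\<in>S. {(x, y), (x + 1, y), (x, y + 1), (x + 1, y + 1)})"

lemma corners_iff:
  "(a, b) \<in> corners S \<longleftrightarrow> (a, b) \<in> S \<or> (a - 1, b) \<in> S \<or> (a, b - 1) \<in> S \<or> (a - 1, b - 1) \<in> S"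
proof -
  have "(a, b) \<in> corners S \<longleftrightarrow> (\<exists>c\<in>S. c = (a, b) \<or> c = (a - 1, b) \<or> c = (a, b - 1) \<or> c = (a - 1, b - 1))"
    unfolding corners_def by (rule iffI; clarsimp) (auto intro!: bexI)
  then show ?thesis by blast
qed

lemma finite_corners: "finite S \<Longrightarrow> finite (corners S)"
  unfolding corners_def by auto

text \<open>Take one cell at each vertex. The offsets from cell to vertex are independent in the two
  coordinates, so the cell supplied by the exchange has the required vertex among its
  corners.\<close>

lemma exchange_corners:
  assumes "\<And>x y x' y'. (x, y) \<in> S \<Longrightarrow> (x', y') \<in> S \<Longrightarrow> (x, y') \<in> S \<or> (x', y) \<in> S"
    and "(a, b) \<in> corners S" "(a', b') \<in> corners S"
  shows "(a, b') \<in> corners S \<or> (a', b) \<in> corners S"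
proof -
  obtain x y where 1: "(x, y) \<in> S" "x = a \<or> x = a - 1" "y = b \<or> y = b - 1"
    using assms(2) unfolding corners_iff by blast
  obtain x' y' where 2: "(x', y') \<in> S" "x' = a' \<or> x' = a' - 1" "y' = b' \<or> y' = b' - 1"
    using assms(3) unfolding corners_iff by blast
  show ?thesis
    using assms(1)[OF 1(1) 2(1)] 1(2,3) 2(2,3) unfolding corners_iff by blast
qed

text \<open>The combinatorial content of L-convexity that the vertex count needs.
  \<open>row_edge\<close> is horizontal convexity on a lattice line: the unit edge leaving
  \<open>(x, y)\<close> to the right lies in the polyomino, hence in a cell above or below
  it.\<close>

locale L_convex_cells =
  fixes S :: "(int \<times> int) set"
  assumes finite_S: "finite S"
    and nonempty_S: "S \<noteq> {}"
    and column_convex: "\<lbrakk>(x, y) \<in> S; (x, y') \<in> S; y \<le> z; z \<le> y'\<rbrakk> \<Longrightarrow> (x, z) \<in> S"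
    and exchange: "\<lbrakk>(x, y) \<in> S; (x', y') \<in> S\<rbrakk> \<Longrightarrow> (x, y') \<in> S \<or> (x', y) \<in> S"
    and row_edge: "\<lbrakk>(x, y) \<in> corners S; (x', y) \<in> corners S; x < x'\<rbrakk>
      \<Longrightarrow> (x, y) \<in> S \<or> (x, y - 1) \<in> S"
begin

text \<open>A row with the most cells works: a column that met another row but not this one would,
  by exchange, make this row a proper subset of the other.\<close>

lemma full_row:
  obtains m where "\<And>x y. (x, y) \<in> S \<Longrightarrow> (x, m) \<in> S"
proof -
  define W where "W y = {x. (x, y) \<in> S}" for y
  have finW: "finite (W y)" for y
    by (rule finite_subset[of _ "fst ` S"]) (use finite_S in \<open>force simp: W_def\<close>)+
  have fin: "finite ((\<lambda>y. card (W y)) ` snd ` S)" "(\<lambda>y. card (W y)) ` snd ` S \<noteq> {}"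
    using finite_S nonempty_S by auto
  obtain m where m: "m \<in> snd ` S" "card (W m) = Max ((\<lambda>y. card (W y)) ` snd ` S)"
    using Max_in[OF fin] by (metis (mono_tags, lifting) imageE)
  have max: "card (W y) \<le> card (W m)" if "y \<in> snd ` S" for y
    unfolding m(2) using fin that by auto
  show ?thesis
  proof (rule that, rule ccontr)
    fix x y assume xy: "(x, y) \<in> S" "(x, m) \<notin> S"
    then have "W m \<subseteq> W y" using exchange unfolding W_def by blast
    moreover have "x \<in> W y" "x \<notin> W m" using xy by (auto simp: W_def)
    ultimately have "card (W m) < card (W y)" using finW by (metis psubset_card_mono psubsetI)
    moreover have "y \<in> snd ` S" using xy by force
    ultimately show False using max[of y] by linarith
  qed
qed

text \<open>This is what turns the bound on the Krull dimension by rows and columns into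
  \<open>n - c \<le> d\<close>. A vertex off the line \<open>y = m\<close> with another vertex to
  its right is hit by \<open>f\<close>: \<open>row_edge\<close> gives a cell above or below the
  edge, and column convexity towards the full row \<open>m\<close> gives the one on the side of
  \<open>m\<close>. What \<open>f\<close> misses is at most one vertex in each row other than
  \<open>m\<close>, plus vertices of row \<open>m\<close>, of which there is at most one per
  column.\<close>

lemma card_corners_le:
  "card (corners S) + 1 \<le> card S + card (fst ` corners S) + card (snd ` corners S)"
proof -
  obtain m where m: "\<And>x y. (x, y) \<in> S \<Longrightarrow> (x, m) \<in> S" using full_row by metis
  \<comment> \<open>\<open>f\<close> sends a cell to its left corner on the side away from the line
    at height \<open>m\<close>, the lower edge of the full row of cells.\<close>
  define f where "f = (\<lambda>(x, y). if m \<le> y then (x, y + 1) else (x, y :: int) :: int \<times> int)"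
  let ?V = "corners S"
  let ?U = "{v \<in> ?V. snd v \<noteq> m \<and> v \<notin> f ` S}"
  have fin: "finite ?V" by (rule finite_corners[OF finite_S])
  have "snd ` ?U \<subseteq> snd ` ?V - {m}" by auto
  then have "card (snd ` ?U) \<le> card (snd ` ?V - {m})" using fin by (intro card_mono) auto
  moreover have "m \<in> snd ` ?V"
  proof -
    obtain x y where "(x, y) \<in> S" using nonempty_S by auto
    then have "(x, m) \<in> ?V" using m by (auto simp: corners_iff)
    then show ?thesis by force
  qed
  moreover from this have "card (snd ` ?V - {m}) + 1 = card (snd ` ?V)"
    using card_Suc_Diff1[of "snd ` ?V" m] fin by simp
  ultimately have rows: "card (snd ` ?U) + 1 \<le> card (snd ` ?V)" by simp
  have last: False if "(x, y) \<in> ?U" "(x', y) \<in> ?U" "x < x'" for x x' y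
  proof -
    have *: "(x, y) \<in> S \<or> (x, y - 1) \<in> S" using row_edge[of x y x'] that by auto
    then have xm: "(x, m) \<in> S" using m by blast
    have "y \<noteq> m" using that(1) by auto
    then consider "m < y" | "y < m" by linarith
    then show False
    proof cases
      case 1
      then have "(x, y - 1) \<in> S" using * column_convex[OF xm, of y "y - 1"] by auto
      then have "f (x, y - 1) \<in> f ` S" by blast
      then show False using that 1 by (auto simp: f_def)
    next
      case 2
      then have "(x, y) \<in> S" using * column_convex[OF _ xm, of "y - 1" y] by auto
      then have "f (x, y) \<in> f ` S" by blast
      then show False using that 2 by (auto simp: f_def)
    qed
  qed
  have "inj_on snd ?U"
  proof (rule inj_onI)
    fix u v assume "u \<in> ?U" "v \<in> ?U" "snd u = snd v"
    then show "u = v" using last[of "fst u" "snd u" "fst v"] last[of "fst v" "snd v" "fst u"]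
      by (cases u; cases v) (force dest: linorder_neqE)
  qed
  then have U: "card ?U = card (snd ` ?U)" by (simp add: card_image)
  have row_m: "card {v \<in> ?V. snd v = m} \<le> card (fst ` ?V)"
    by (rule card_inj_on_le[of fst]) (use fin in \<open>auto simp: inj_on_def prod_eq_iff\<close>)
  have "?V \<subseteq> f ` S \<union> {v \<in> ?V. snd v = m} \<union> ?U" by auto
  then have "card ?V \<le> card (f ` S \<union> {v \<in> ?V. snd v = m} \<union> ?U)"
    by (rule card_mono[rotated]) (use fin finite_S in auto)
  also have "\<dots> \<le> card (f ` S) + card {v \<in> ?V. snd v = m} + card ?U"
    by (meson add_le_mono card_Un_le le_refl order_trans)
  finally show ?thesis using card_image_le[OF finite_S, of f] U rows row_m by linarith
qed

end

section \<open>Counting rectangles and pairs of rooks\<close>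

definition rectangles :: "(int \<times> int) set \<Rightarrow> ((int \<times> int) \<times> (int \<times> int)) set" where
  "rectangles V = {((x, y), (x', y')) | x y x' y'.
     x < x' \<and> y < y' \<and> {(x, y), (x', y), (x, y'), (x', y')} \<subseteq> V}"

definition rook_pairs :: "(int \<times> int) set \<Rightarrow> (int \<times> int) set set" where
  "rook_pairs S = {T. T \<subseteq> S \<and> card T = 2 \<and>
     (\<forall>c\<in>T. \<forall>d\<in>T. c \<noteq> d \<longrightarrow> fst c \<noteq> fst d \<and> snd c \<noteq> snd d)}"

lemma finite_rectangles: "finite V \<Longrightarrow> finite (rectangles V)"
  by (rule finite_subset[of _ "V \<times> V"]) (auto simp: rectangles_def)

text \<open>Cells, attacking pairs and a \<open>2 \<times> 2\<close> square span rectangles of pairwise different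
  shapes \<open>1 \<times> 1\<close>, \<open>k \<times> 1\<close>, \<open>1 \<times> k\<close> (\<open>k \<ge> 2\<close>) and \<open>2 \<times> 2\<close>.\<close>

lemma choose_two_less_rook_pairs_plus_rectangles:
  assumes fin: "finite S" and square: "{(a, b), (a + 1, b), (a, b + 1), (a + 1, b + 1)} \<subseteq> S"
  shows "(card S choose 2) + card S < card (rook_pairs S) + card (rectangles (corners S))"
proof -
  define RP where "RP = {(c, d). c \<in> S \<and> d \<in> S \<and> snd c = snd d \<and> fst c < fst d}"
  define CP where "CP = {(c, d). c \<in> S \<and> d \<in> S \<and> fst c = fst d \<and> snd c < snd d}"
  have finP: "finite RP" "finite CP"
    by (rule finite_subset[of _ "S \<times> S"]; use fin in \<open>auto simp: RP_def CP_def\<close>)+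
  have finR: "finite (rook_pairs S)"
    by (rule finite_subset[of _ "Pow S"]) (use fin in \<open>auto simp: rook_pairs_def\<close>)
  let ?pair = "\<lambda>(c, d). {c, d}"
  have "{T. T \<subseteq> S \<and> card T = 2} \<subseteq> rook_pairs S \<union> ?pair ` RP \<union> ?pair ` CP"
  proof
    fix T assume T: "T \<in> {T. T \<subseteq> S \<and> card T = 2}"
    then obtain c d where cd: "T = {c, d}" "c \<noteq> d" by (auto simp: card_2_iff)
    consider "snd c = snd d" "fst c < fst d" | "snd c = snd d" "fst d < fst c"
      | "fst c = fst d" "snd c < snd d" | "fst c = fst d" "snd d < snd c"
      | "fst c \<noteq> fst d" "snd c \<noteq> snd d"
      using cd(2) by (metis linorder_neqE prod_eqI)
    then show "T \<in> rook_pairs S \<union> ?pair ` RP \<union> ?pair ` CP"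
    proof cases
      case 1
      then have "(c, d) \<in> RP" using T cd by (auto simp: RP_def)
      then have "T \<in> ?pair ` RP" using cd by (intro image_eqI[of _ _ "(c, d)"]) auto
      then show ?thesis by blast
    next
      case 2
      then have "(d, c) \<in> RP" using T cd by (auto simp: RP_def)
      then have "T \<in> ?pair ` RP" using cd by (intro image_eqI[of _ _ "(d, c)"]) auto
      then show ?thesis by blast
    next
      case 3
      then have "(c, d) \<in> CP" using T cd by (auto simp: CP_def)
      then have "T \<in> ?pair ` CP" using cd by (intro image_eqI[of _ _ "(c, d)"]) auto
      then show ?thesis by blast
    next
      case 4
      then have "(d, c) \<in> CP" using T cd by (auto simp: CP_def)
      then have "T \<in> ?pair ` CP" using cd by (intro image_eqI[of _ _ "(d, c)"]) auto
      then show ?thesis by blast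
    next
      case 5
      then show ?thesis using T cd by (auto simp: rook_pairs_def)
    qed
  qed
  then have "card {T. T \<subseteq> S \<and> card T = 2} \<le> card (rook_pairs S \<union> ?pair ` RP \<union> ?pair ` CP)"
    by (rule card_mono[rotated]) (use finP finR in auto)
  also have "\<dots> \<le> card (rook_pairs S) + card (?pair ` RP) + card (?pair ` CP)"
    by (meson add_le_mono card_Un_le le_refl order_trans)
  also have "\<dots> \<le> card (rook_pairs S) + card RP + card CP"
    using finP by (intro add_mono card_image_le) auto
  finally have pairs: "card S choose 2 \<le> card (rook_pairs S) + card RP + card CP"
    using n_subsets[OF fin, of 2] by simp
  \<comment> \<open>From the lower left corner of \<open>c\<close> to the upper right corner of
    \<open>d\<close>. Encoding a single cell as \<open>(c, c)\<close> lets one injective map serve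
    cells and attacking pairs alike.\<close>
  define bounding where "bounding = (\<lambda>(c, d). (c, (fst d + 1, snd d + 1)) :: (int \<times> int) \<times> (int \<times> int))"
  define P where "P = (\<lambda>c. (c, c)) ` S \<union> RP \<union> CP"
  have inj: "inj bounding" unfolding bounding_def inj_def by auto
  \<comment> \<open>The diagonal of the given square shares neither row nor column, so it is not yet
    counted; this is where strictness comes from.\<close>
  have new: "((a, b), (a + 1, b + 1)) \<notin> P" by (auto simp: P_def RP_def CP_def)
  have "bounding ` insert ((a, b), (a + 1, b + 1)) P \<subseteq> rectangles (corners S)"
    using square unfolding P_def RP_def CP_def rectangles_def bounding_def
    by (auto simp: corners_iff add.commute)
  then have "card (insert ((a, b), (a + 1, b + 1)) P) \<le> card (rectangles (corners S))"
    using card_inj_on_le[OF inj_on_subset[OF inj subset_UNIV]]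
      finite_rectangles[OF finite_corners[OF fin]] by blast
  moreover have "card (insert ((a, b), (a + 1, b + 1)) P) = card P + 1"
    using new finP fin by (simp add: P_def)
  moreover have "card P = card S + card RP + card CP"
  proof -
    have "card P = card ((\<lambda>c. (c, c)) ` S \<union> RP) + card CP"
      unfolding P_def by (rule card_Un_disjoint) (use finP fin in \<open>auto simp: RP_def CP_def\<close>)
    also have "card ((\<lambda>c. (c, c)) ` S \<union> RP) = card ((\<lambda>c. (c, c)) ` S) + card RP"
      by (rule card_Un_disjoint) (use finP fin in \<open>auto simp: RP_def\<close>)
    also have "card ((\<lambda>c. (c, c)) ` S) = card S" by (rule card_image) (auto simp: inj_on_def)
    finally show ?thesis .
  qed
  ultimately show ?thesis using pairs by linarith
qed

text \<open>By exchange the sets \<open>N y\<close> form a chain under inclusion, so their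
  cardinalities order them; only ties have to be broken to make the rank injective.\<close>

lemma exchange_rank:
  fixes V :: "('a \<times> int) set"
  assumes fin: "finite V"
    and ex: "\<forall>x y x' y'. (x, y) \<in> V \<longrightarrow> (x', y') \<in> V \<longrightarrow> (x, y') \<in> V \<or> (x', y) \<in> V"
  shows "\<exists>\<rho> :: int \<Rightarrow> nat. inj_on \<rho> (snd ` V) \<and>
    (\<forall>x y y'. (x, y) \<in> V \<longrightarrow> y' \<in> snd ` V \<longrightarrow> \<rho> y < \<rho> y' \<longrightarrow> (x, y') \<in> V)"
proof -
  define N where "N y = {x. (x, y) \<in> V}" for y
  have finN: "finite (N y)" for y
    by (rule finite_subset[of _ "fst ` V"]) (use fin in \<open>force simp: N_def\<close>)+
  obtain M where M: "\<And>y. y \<in> snd ` V \<Longrightarrow> \<bar>y\<bar> < M"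
  proof -
    have fin': "finite (abs ` snd ` V)" using fin by simp
    have "\<bar>y\<bar> < Max (insert 0 (abs ` snd ` V)) + 1" if "y \<in> snd ` V" for y
    proof -
      have "\<bar>y\<bar> \<le> Max (insert 0 (abs ` snd ` V))" using that fin' by (intro Max_ge) auto
      then show ?thesis by simp
    qed
    then show ?thesis using that by blast
  qed
  \<comment> \<open>For occurring \<open>y\<close> the part \<open>y + M\<close> lies strictly
    between \<open>0\<close> and \<open>2 * M\<close>, so it separates rows of equal size without
    overturning a comparison of sizes, and the rank stays nonnegative.\<close>
  define r where "r y = 2 * M * int (card (N y)) + y + M" for y
  have nonneg: "0 \<le> r y" if "y \<in> snd ` V" for y
  proof -
    have "0 \<le> 2 * M * int (card (N y))" using M[OF that] by (intro mult_nonneg_nonneg) auto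
    then show ?thesis using M[OF that] unfolding r_def by linarith
  qed
  have mono: "r y < r y'" if "y \<in> snd ` V" "y' \<in> snd ` V" "card (N y) < card (N y')" for y y'
  proof -
    have "0 < M" using M[OF that(1)] by linarith
    then have "2 * M * (int (card (N y)) + 1) \<le> 2 * M * int (card (N y'))"
      using that(3) by (intro mult_left_mono) auto
    then have "2 * M * int (card (N y)) + 2 * M \<le> 2 * M * int (card (N y'))"
      by (simp add: algebra_simps)
    then show ?thesis unfolding r_def using M[OF that(1)] M[OF that(2)] by linarith
  qed
  show ?thesis
  proof (intro exI[of _ "\<lambda>y. nat (r y)"] conjI allI impI)
    show "inj_on (\<lambda>y. nat (r y)) (snd ` V)"
    proof (rule inj_onI)
      fix y y' assume y: "y \<in> snd ` V" "y' \<in> snd ` V" "nat (r y) = nat (r y')"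
      then have "r y = r y'" using nonneg by (simp add: eq_nat_nat_iff)
      moreover from this have "card (N y) = card (N y')"
        using mono[OF y(1,2)] mono[OF y(2,1)] by (metis less_irrefl linorder_neqE_nat)
      ultimately show "y = y'" by (simp add: r_def)
    qed
    fix x y y' assume xy: "(x, y) \<in> V" and y': "y' \<in> snd ` V" and lt: "nat (r y) < nat (r y')"
    show "(x, y') \<in> V"
    proof (rule ccontr)
      assume "(x, y') \<notin> V"
      then have "N y' \<subset> N y" using ex xy unfolding N_def by blast
      then have "card (N y') < card (N y)" using finN by (simp add: psubset_card_mono)
      moreover have "y \<in> snd ` V" using xy by force
      ultimately show False using mono[OF y'] lt by fastforce
    qed
  qed
qed

text \<open>Convexity is applied to test points: vertical segments between cell centres give
  \<open>column_convex\<close>, and the midpoint of a horizontal lattice edge gives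
  \<open>row_edge\<close>.\<close>

lemma L_convex_discrete:
  assumes X: "L_convex X" and ne: "cells X \<noteq> {}"
  shows "L_convex_cells (cells X)" and "vertex_set X = corners (cells X)"
proof -
  obtain S where S: "finite S" "X = (\<Union>c\<in>S. cell c)"
    using X unfolding L_convex_def convex_polyomino_def polyomino_def by auto
  have conv: "horizontally_convex X" "vertically_convex X"
    using X unfolding L_convex_def convex_polyomino_def by auto
  note [simp] = cells_Union(1)[OF S(2)]
  have V: "vertex_set X = corners S"
  proof -
    have "v \<in> vertex_set X \<longleftrightarrow> v \<in> corners S" for v
      unfolding vertex_set_def S(2) corners_def
      by (cases v) (force simp: lattice_point_cell_iff split: prod.splits)
    then show ?thesis by blast
  qed
  then show "vertex_set X = corners (cells X)" by simp
  show "L_convex_cells (cells X)"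
  proof
    show "finite (cells X)" using S(1) by simp
    show "cells X \<noteq> {}" by (rule ne)
    show "(x, z) \<in> cells X" if "(x, y) \<in> cells X" "(x, y') \<in> cells X" "y \<le> z" "z \<le> y'" for x y y' z
      using vertical_segment_mem[OF conv(2), of "real_of_int x + 1/2" "real_of_int y + 1/2"
          "real_of_int y' + 1/2" "real_of_int z + 1/2"] that cells_Union(2)[OF S(2)] by simp
    show "(x, y') \<in> cells X \<or> (x', y) \<in> cells X" if c: "(x, y) \<in> cells X" "(x', y') \<in> cells X" for x y x' y'
    proof -
      obtain p where "cell_path X p" "hd p = (x, y)" "last p = (x', y')" "monotone_path p"
        "card (direction_changes p) \<le> 1"
        using X c unfolding L_convex_def by blast
      then show ?thesis using L_path_corner[of X p] by simp
    qed
    show "(x, y) \<in> cells X \<or> (x, y - 1) \<in> cells X"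
      if "(x, y) \<in> corners (cells X)" "(x', y) \<in> corners (cells X)" "x < x'" for x y x'
    proof -
      have "lattice_point (x, y) \<in> X" "lattice_point (x', y) \<in> X"
        using that V by (auto simp: vertex_set_def)
      then have "(real_of_int x + 1/2, real_of_int y) \<in> X"
        using horizontal_segment_mem[OF conv(1), of "real_of_int x" "real_of_int y" "real_of_int x'"
            "real_of_int x + 1/2"] that(3) by (simp add: lattice_point_def)
      then obtain c where "c \<in> S" "(real_of_int x + 1/2, real_of_int y) \<in> cell c"
        using S(2) by blast
      then show ?thesis using edge_midpoint_iff(1)[of x y c] by auto
    qed
  qed
qed

subsection \<open>Monomials and toric evaluation\<close>

lemma keys_add_nat [simp]:
  fixes m m' :: "'a \<Rightarrow>\<^sub>0 nat"
  shows "Poly_Mapping.keys (m + m') = Poly_Mapping.keys m \<union> Poly_Mapping.keys m'"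
  by (auto simp: in_keys_iff lookup_add)

lemma monomial_degree_add:
  "monomial_degree (m + m') = monomial_degree m + monomial_degree m'"
  unfolding monomial_degree_def by (rule setsum_keys_plus_distrib) auto

lemma monomial_degree_0 [simp]: "monomial_degree 0 = 0"
  by (simp add: monomial_degree_def)

lemma monomial_degree_single [simp]: "monomial_degree (Poly_Mapping.single v k) = k"
  by (simp add: monomial_degree_def)

lemma monomial_degree_eq_0_iff [simp]: "monomial_degree m = 0 \<longleftrightarrow> m = 0"
  by (auto simp: monomial_degree_def in_keys_iff intro: poly_mapping_eqI)

lemma remove_variable:
  assumes "v \<in> Poly_Mapping.keys m"
  obtains m' where "m = m' + Poly_Mapping.single v (1 :: nat)"
proof (rule that)
  show "m = (m - Poly_Mapping.single v 1) + Poly_Mapping.single v 1"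
    using assms by (auto simp: poly_mapping_eq_iff fun_eq_iff lookup_add lookup_minus lookup_single
        in_keys_iff when_def)
qed

text \<open>The map \<open>x\<^sub>(\<^sub>a\<^sub>,\<^sub>b\<^sub>) \<mapsto> s\<^sub>a t\<^sub>b\<close> on exponents, where the variables \<open>s\<^sub>a\<close> and \<open>t\<^sub>b\<close> are numbered
  \<open>2 a\<close> and \<open>2 b + 1\<close>: the linearly ordered index set makes the target a domain.\<close>

definition toric_exponent :: "((int \<times> int) \<Rightarrow>\<^sub>0 nat) \<Rightarrow> (int \<Rightarrow>\<^sub>0 nat)" where
  "toric_exponent m = (\<Sum>v\<in>Poly_Mapping.keys m.
     Poly_Mapping.single (2 * fst v) (Poly_Mapping.lookup m v) +
     Poly_Mapping.single (2 * snd v + 1) (Poly_Mapping.lookup m v))"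

lemma toric_exponent_add: "toric_exponent (m + m') = toric_exponent m + toric_exponent m'"
  unfolding toric_exponent_def by (rule setsum_keys_plus_distrib) (auto simp: single_add add_ac)

lemma toric_exponent_0 [simp]: "toric_exponent 0 = 0"
  by (simp add: toric_exponent_def)

lemma toric_exponent_single:
  "toric_exponent (Poly_Mapping.single (a, b) k) =
     Poly_Mapping.single (2 * a) k + Poly_Mapping.single (2 * b + 1) k"
  by (simp add: toric_exponent_def)

text \<open>Parity keeps column and row variables apart, and natural exponents cannot cancel, so the
  toric image still shows which columns and rows occur.\<close>

lemma toric_exponent_keys:
  shows "2 * a \<in> Poly_Mapping.keys (toric_exponent m) \<longleftrightarrow> a \<in> fst ` Poly_Mapping.keys m"
    and "2 * b + 1 \<in> Poly_Mapping.keys (toric_exponent m) \<longleftrightarrow> b \<in> snd ` Poly_Mapping.keys m"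
proof -
  have odd: "2 * x \<noteq> 2 * y + 1" for x y :: int by presburger
  show "2 * a \<in> Poly_Mapping.keys (toric_exponent m) \<longleftrightarrow> a \<in> fst ` Poly_Mapping.keys m"
    unfolding toric_exponent_def in_keys_iff[of "2 * a"]
    by (auto simp: lookup_sum lookup_add lookup_single when_def odd odd[symmetric] in_keys_iff)
  show "2 * b + 1 \<in> Poly_Mapping.keys (toric_exponent m) \<longleftrightarrow> b \<in> snd ` Poly_Mapping.keys m"
    unfolding toric_exponent_def in_keys_iff[of "2 * b + 1"]
    by (auto simp: lookup_sum lookup_add lookup_single when_def odd odd[symmetric] in_keys_iff)
qed

text \<open>The toric map followed by the projection onto the face \<open>F\<close>.\<close>

definition toric_eval :: "(int \<times> int) set \<Rightarrow> 'k::field mpolynomial \<Rightarrow> (int \<Rightarrow>\<^sub>0 nat) \<Rightarrow>\<^sub>0 'k" where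
  "toric_eval F p = (\<Sum>m\<in>Poly_Mapping.keys p. if Poly_Mapping.keys m \<subseteq> F
     then Poly_Mapping.single (toric_exponent m) (Poly_Mapping.lookup p m) else 0)"

lemma toric_eval_0 [simp]: "toric_eval F 0 = 0"
  by (simp add: toric_eval_def)

lemma toric_eval_single:
  "toric_eval F (Poly_Mapping.single m c) =
     (if Poly_Mapping.keys m \<subseteq> F then Poly_Mapping.single (toric_exponent m) c else 0)"
  by (simp add: toric_eval_def)

lemma toric_eval_add: "toric_eval F (p + q) = toric_eval F p + toric_eval F q"
  unfolding toric_eval_def by (rule setsum_keys_plus_distrib) (auto simp: single_add)

lemma toric_eval_sum: "toric_eval F (\<Sum>i\<in>A. f i) = (\<Sum>i\<in>A. toric_eval F (f i))"
  by (induction A rule: infinite_finite_induct) (auto simp: toric_eval_add)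

lemma toric_eval_uminus: "toric_eval F (- p) = - toric_eval F p"
proof -
  have "toric_eval F (- p) + toric_eval F p = 0"
    by (simp flip: toric_eval_add)
  then show ?thesis by (simp add: eq_neg_iff_add_eq_0)
qed

lemma toric_eval_diff: "toric_eval F (p - q) = toric_eval F p - toric_eval F q"
  using toric_eval_add[of F p "- q"] by (simp add: toric_eval_uminus)

lemma poly_mapping_sum_single:
  "p = (\<Sum>m\<in>Poly_Mapping.keys p. Poly_Mapping.single m (Poly_Mapping.lookup p m))"
  by (rule poly_mapping_eqI)
     (simp add: lookup_sum lookup_single when_def in_keys_iff sum.delta' flip: sum.inter_filter)

text \<open>A product of monomials lies on \<open>F\<close> exactly when both factors do, so
  dropping the other monomials respects products; the rest is bilinear extension.\<close>

lemma toric_eval_mult: "toric_eval F (p * q) = toric_eval F p * toric_eval F q"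
proof -
  have 1: "toric_eval F (Poly_Mapping.single m c * Poly_Mapping.single m' c') =
      toric_eval F (Poly_Mapping.single m c) * toric_eval F (Poly_Mapping.single m' c')"
    for m m' and c c' :: 'a
    by (auto simp: mult_single toric_eval_single toric_exponent_add)
  have 2: "toric_eval F (Poly_Mapping.single m c * q) = toric_eval F (Poly_Mapping.single m c) * toric_eval F q"
    for m and c :: 'a and q :: "'a mpolynomial"
    by (subst (1 2) poly_mapping_sum_single[of q])
       (simp only: sum_distrib_left toric_eval_sum 1)
  show ?thesis
    by (subst (1 2) poly_mapping_sum_single[of p])
       (simp only: sum_distrib_right toric_eval_sum 2)
qed

lemma toric_eval_1: "toric_eval F 1 = 1"
  using toric_eval_single[of F 0 1] by simp

lemma toric_eval_var: "toric_eval F (var v) = 0 \<longleftrightarrow> v \<notin> F"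
proof -
  have "Poly_Mapping.single a (1 :: 'a) \<noteq> 0" for a :: "int \<Rightarrow>\<^sub>0 nat"
    by (metis lookup_single_eq lookup_zero zero_neq_one)
  then show ?thesis by (auto simp: var_def toric_eval_single)
qed

text \<open>Both monomials have the same toric exponent, and by the hypothesis the projection keeps
  both or drops both.\<close>

lemma toric_eval_binomial:
  assumes "(a, b) \<in> F \<and> (a', b') \<in> F \<longleftrightarrow> (a, b') \<in> F \<and> (a', b) \<in> F"
  shows "toric_eval F (var (a, b) * var (a', b') - var (a, b') * var (a', b)) = 0"
  using assms
  by (auto simp: toric_eval_diff var_def mult_single toric_eval_single toric_exponent_add
      toric_exponent_single algebra_simps)


subsection \<open>Tableaux whose rows and columns are ordered by inclusion\<close>

text \<open>The Ferrers shape up to permutation: larger \<open>\<gamma>\<close> means a larger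
  column and larger \<open>\<rho>\<close> a larger row, with respect to inclusion.\<close>

locale ranked_tableau =
  fixes V :: "(int \<times> int) set" and \<gamma> \<rho> :: "int \<Rightarrow> nat"
  assumes finite_V: "finite V" and nonempty_V: "V \<noteq> {}"
    and inj_\<gamma>: "inj_on \<gamma> (fst ` V)" and inj_\<rho>: "inj_on \<rho> (snd ` V)"
    and \<gamma>_mono: "\<lbrakk>(x, y) \<in> V; x' \<in> fst ` V; \<gamma> x < \<gamma> x'\<rbrakk> \<Longrightarrow> (x', y) \<in> V"
    and \<rho>_mono: "\<lbrakk>(x, y) \<in> V; y' \<in> snd ` V; \<rho> y < \<rho> y'\<rbrakk> \<Longrightarrow> (x, y') \<in> V"
begin

text \<open>This diagonal of a rectangle, and not the other one, forces the remaining two corners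
  into \<open>V\<close>: each arises from \<open>u\<close> by raising one rank.\<close>

definition crossing :: "int \<times> int \<Rightarrow> int \<times> int \<Rightarrow> bool" where
  "crossing u v \<longleftrightarrow> \<gamma> (fst u) < \<gamma> (fst v) \<and> \<rho> (snd u) < \<rho> (snd v)"

text \<open>Being defined by a condition on pairs, the stairs form a flag complex; its faces are the
  supports of the basis monomials.\<close>

definition stair :: "(int \<times> int) set \<Rightarrow> bool" where
  "stair F \<longleftrightarrow> F \<subseteq> V \<and> (\<forall>u\<in>F. \<forall>v\<in>F. \<not> crossing u v)"

lemma stair_subset: "stair F \<Longrightarrow> G \<subseteq> F \<Longrightarrow> stair G"
  unfolding stair_def by blast

lemma finite_stair: "stair F \<Longrightarrow> finite F"
  unfolding stair_def using finite_V finite_subset by blast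

lemma crossing_corners:
  assumes "u \<in> V" "v \<in> V" "crossing u v"
  shows "(fst u, snd v) \<in> V" "(fst v, snd u) \<in> V"
  using assms \<gamma>_mono[of "fst u" "snd u" "fst v"] \<rho>_mono[of "fst u" "snd u" "snd v"]
  unfolding crossing_def by auto

text \<open>Choose \<open>(x, y1)\<close> and \<open>(x1, y)\<close> in \<open>F\<close>. If neither
  were the corner, \<open>(x1, y)\<close> would cross \<open>(x, y1)\<close>. The point is that the
  corner depends only on the two projections of \<open>F\<close>.\<close>

lemma stair_corner:
  assumes F: "stair F" and x: "x \<in> fst ` F" "\<And>x'. x' \<in> fst ` F \<Longrightarrow> \<gamma> x' \<le> \<gamma> x"
    and y: "y \<in> snd ` F" "\<And>y'. y' \<in> snd ` F \<Longrightarrow> \<rho> y \<le> \<rho> y'"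
  shows "(x, y) \<in> F"
proof -
  obtain y1 where 1: "(x, y1) \<in> F" using x(1) by force
  obtain x1 where 2: "(x1, y) \<in> F" using y(1) by force
  have "x1 \<in> fst ` V" "x \<in> fst ` V" "y1 \<in> snd ` V" "y \<in> snd ` V"
    using F 1 2 unfolding stair_def by force+
  moreover have "\<not> (\<gamma> x1 < \<gamma> x \<and> \<rho> y < \<rho> y1)"
    using F 1 2 unfolding stair_def crossing_def by force
  moreover have "\<gamma> x1 \<le> \<gamma> x" "\<rho> y \<le> \<rho> y1" using x(2) y(2) 1 2 by force+
  ultimately have "x1 = x \<or> y1 = y"
    using inj_\<gamma> inj_\<rho> by (metis inj_onD le_neq_implies_less)
  then show ?thesis using 1 2 by auto
qed

lemma stair_corner_exists:
  assumes F: "stair F" "F \<noteq> {}" and G: "stair G" "fst ` G = fst ` F" "snd ` G = snd ` F"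
  obtains u where "u \<in> F" "u \<in> G"
proof -
  have fin: "finite (fst ` F)" "finite (snd ` F)" using finite_stair[OF F(1)] by auto
  have *: "finite (\<gamma> ` fst ` F)" "\<gamma> ` fst ` F \<noteq> {}" "finite (\<rho> ` snd ` F)" "\<rho> ` snd ` F \<noteq> {}"
    using fin F by auto
  obtain x where x: "x \<in> fst ` F" "\<gamma> x = Max (\<gamma> ` fst ` F)"
    using Max_in[OF *(1,2)] by (metis (mono_tags, lifting) imageE)
  obtain y where y: "y \<in> snd ` F" "\<rho> y = Min (\<rho> ` snd ` F)"
    using Min_in[OF *(3,4)] by (metis (mono_tags, lifting) imageE)
  have max: "\<gamma> x' \<le> \<gamma> x" if "x' \<in> fst ` F" for x'
    unfolding x(2) using * that by (intro Max_ge) auto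
  have min: "\<rho> y \<le> \<rho> y'" if "y' \<in> snd ` F" for y'
    unfolding y(2) using * that by (intro Min_le) auto
  have "(x, y) \<in> F" "(x, y) \<in> G"
    using stair_corner[OF F(1) x(1) max y(1) min] stair_corner[OF G(1), of x y] G(2,3) x(1) y(1) max min
    by blast+
  then show ?thesis by (rule that)
qed

text \<open>Of two vertices that do not cross, one has weakly larger column rank and weakly smaller
  row rank. Hence \<open>g\<close>, counting columns up to \<open>u\<close> and rows from
  \<open>u\<close> on, is injective on a stair; both counts are positive, so its values start at
  2.\<close>

lemma card_stair:
  assumes "stair F" "F \<noteq> {}"
  shows "card F + 1 \<le> card (fst ` V) + card (snd ` V)"
proof -
  define A where "A u = {x \<in> fst ` V. \<gamma> x \<le> \<gamma> (fst u)}" for u :: "int \<times> int"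
  define B where "B u = {y \<in> snd ` V. \<rho> (snd u) \<le> \<rho> y}" for u :: "int \<times> int"
  define g where "g u = card (A u) + card (B u)" for u
  have fin: "finite (A u)" "finite (B u)" for u using finite_V by (auto simp: A_def B_def)
  have less: "g u < g v"
    if "u \<in> V" "v \<in> V" "u \<noteq> v" "\<gamma> (fst u) \<le> \<gamma> (fst v)" "\<rho> (snd v) \<le> \<rho> (snd u)" for u v
  proof -
    have sub: "A u \<subseteq> A v" "B u \<subseteq> B v" using that by (auto simp: A_def B_def)
    have "fst u \<noteq> fst v \<or> snd u \<noteq> snd v" using that(3) by (simp add: prod_eq_iff)
    then have "\<gamma> (fst u) \<noteq> \<gamma> (fst v) \<or> \<rho> (snd u) \<noteq> \<rho> (snd v)"
      using that(1,2) inj_\<gamma> inj_\<rho> by (meson imageI inj_onD)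
    then have "A u \<subset> A v \<or> B u \<subset> B v"
    proof
      assume "\<gamma> (fst u) \<noteq> \<gamma> (fst v)"
      then have "fst v \<in> A v" "fst v \<notin> A u" using that by (auto simp: A_def)
      then show ?thesis using sub by blast
    next
      assume "\<rho> (snd u) \<noteq> \<rho> (snd v)"
      then have "snd v \<in> B v" "snd v \<notin> B u" using that by (auto simp: B_def)
      then show ?thesis using sub by blast
    qed
    then have "card (A u) < card (A v) \<or> card (B u) < card (B v)"
      using fin psubset_card_mono by blast
    moreover have "card (A u) \<le> card (A v)" "card (B u) \<le> card (B v)"
      using sub fin by (simp_all add: card_mono)
    ultimately show ?thesis unfolding g_def by linarith
  qed
  have "inj_on g F"
  proof (rule inj_onI, rule ccontr)
    fix u v assume uv: "u \<in> F" "v \<in> F" "g u = g v" "u \<noteq> v"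
    then have "u \<in> V" "v \<in> V" and "\<not> crossing u v" "\<not> crossing v u" using assms by (auto simp: stair_def)
    then show False
      using less[of u v] less[of v u] uv(3,4) unfolding crossing_def by fastforce
  qed
  moreover have "g ` F \<subseteq> {2..card (fst ` V) + card (snd ` V)}"
  proof
    fix k assume "k \<in> g ` F"
    then obtain u where u: "u \<in> V" "k = g u" using assms by (auto simp: stair_def)
    then have "fst u \<in> A u" "snd u \<in> B u" by (auto simp: A_def B_def)
    then have "card (A u) > 0" "card (B u) > 0" using fin by (auto simp: card_gt_0_iff)
    moreover have "card (A u) \<le> card (fst ` V)" "card (B u) \<le> card (snd ` V)"
      using finite_V by (auto simp: A_def B_def intro!: card_mono)
    ultimately show "k \<in> {2..card (fst ` V) + card (snd ` V)}" using u by (auto simp: g_def)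
  qed
  ultimately have "card F \<le> card {2..card (fst ` V) + card (snd ` V)}"
    by (rule card_inj_on_le) simp
  moreover have "card (fst ` V) > 0" "card (snd ` V) > 0"
    using finite_V nonempty_V by (auto simp: card_gt_0_iff)
  ultimately show ?thesis by simp
qed

text \<open>One diagonal of every rectangle is a crossing pair, and the rectangle is recovered from
  the two projections of that diagonal.\<close>

lemma stair_pairs_plus_rectangles:
  "card {F. stair F \<and> card F = 2} + card (rectangles V) \<le> card V choose 2"
proof -
  \<comment> \<open>A rectangle is given by coordinates, crossing by ranks: the test asks whether
    the ranks order columns and rows in the same sense.\<close>
  define h where "h = (\<lambda>((x, y), (x', y')).
    if \<gamma> x < \<gamma> x' \<longleftrightarrow> \<rho> y < \<rho> y' then {(x, y), (x', y')} else {(x, y'), (x', y)})"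
  have fin: "finite (Pow V)" using finite_V by simp
  have "inj_on h (rectangles V)"
  proof (rule inj_onI)
    fix r s assume rs: "r \<in> rectangles V" "s \<in> rectangles V" "h r = h s"
    obtain x y x' y' where r: "r = ((x, y), (x', y'))" "x < x'" "y < y'"
      using rs(1) unfolding rectangles_def by blast
    obtain a b a' b' where s: "s = ((a, b), (a', b'))" "a < a'" "b < b'"
      using rs(2) unfolding rectangles_def by blast
    have "fst ` h r = {x, x'}" "snd ` h r = {y, y'}" "fst ` h s = {a, a'}" "snd ` h s = {b, b'}"
      unfolding r s h_def by auto
    then have "{x, x'} = {a, a'}" "{y, y'} = {b, b'}" using rs(3) by auto
    then show "r = s" using r s by (auto simp: doubleton_eq_iff)
  qed
  moreover have "h r \<in> {F. F \<subseteq> V \<and> card F = 2} - {F. stair F \<and> card F = 2}"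
    if rV: "r \<in> rectangles V" for r
  proof -
    obtain x y x' y' where r: "r = ((x, y), (x', y'))" "x < x'" "y < y'"
      and V: "(x, y) \<in> V" "(x', y) \<in> V" "(x, y') \<in> V" "(x', y') \<in> V"
      using rV unfolding rectangles_def by blast
    have "x \<in> fst ` V" "x' \<in> fst ` V" "y \<in> snd ` V" "y' \<in> snd ` V" using V by force+
    then have "\<gamma> x \<noteq> \<gamma> x'" "\<rho> y \<noteq> \<rho> y'"
      using inj_onD[OF inj_\<gamma>, of x x'] inj_onD[OF inj_\<rho>, of y y'] r by auto
    then have "\<not> stair (h r)"
      unfolding r h_def stair_def crossing_def by (auto simp: not_less)
    moreover have "card (h r) = 2" "h r \<subseteq> V" using r V by (auto simp: h_def)
    ultimately show ?thesis by blast
  qed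
  ultimately have "card (rectangles V) \<le> card ({F. F \<subseteq> V \<and> card F = 2} - {F. stair F \<and> card F = 2})"
    by (intro card_inj_on_le[of h] image_subsetI) (auto intro: finite_subset[OF _ fin])
  also have "\<dots> = card {F. F \<subseteq> V \<and> card F = 2} - card {F. stair F \<and> card F = 2}"
    by (rule card_Diff_subset) (auto simp: stair_def intro: finite_subset[OF _ fin])
  also have "card {F. F \<subseteq> V \<and> card F = 2} = card V choose 2" by (rule n_subsets[OF finite_V])
  finally have *: "card (rectangles V) \<le> (card V choose 2) - card {F. stair F \<and> card F = 2}" .
  have "card {F. stair F \<and> card F = 2} \<le> card {F. F \<subseteq> V \<and> card F = 2}"
    by (rule card_mono) (auto simp: stair_def intro: finite_subset[OF _ fin])
  then show ?thesis using * n_subsets[OF finite_V, of 2] by simp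
qed

text \<open>Equal toric exponents mean equal projections of the supports, hence a common extremal
  corner. Its variable divides both monomials and is cancelled.\<close>

lemma toric_exponent_inj_on_stairs:
  assumes "stair (Poly_Mapping.keys m)" "stair (Poly_Mapping.keys m')"
    and "toric_exponent m = toric_exponent m'"
  shows "m = m'"
  using assms
proof (induction "monomial_degree m" arbitrary: m m')
  case 0
  then have "m = 0" by simp
  have "2 * fst v \<notin> Poly_Mapping.keys (toric_exponent m')" for v
    using 0 \<open>m = 0\<close> by (simp flip: 0(4))
  then have "fst ` Poly_Mapping.keys m' = {}"
    using toric_exponent_keys(1)[of _ m'] by (metis all_not_in_conv fst_conv)
  then show ?case using \<open>m = 0\<close> by (metis image_is_empty keys_eq_empty)
next
  case (Suc n)
  have proj: "fst ` Poly_Mapping.keys m' = fst ` Poly_Mapping.keys m"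
    by (rule Set.set_eqI) (simp only: toric_exponent_keys[symmetric] Suc.prems(3))
  have proj': "snd ` Poly_Mapping.keys m' = snd ` Poly_Mapping.keys m"
    by (rule Set.set_eqI) (simp only: toric_exponent_keys[symmetric] Suc.prems(3))
  have "m \<noteq> 0" using Suc(2) by force
  then have "Poly_Mapping.keys m \<noteq> {}" by simp
  then obtain u where u: "u \<in> Poly_Mapping.keys m" "u \<in> Poly_Mapping.keys m'"
    using stair_corner_exists[OF Suc.prems(1) _ Suc.prems(2) proj proj'] by blast
  obtain n1 where n1: "m = n1 + Poly_Mapping.single u 1" using u(1) by (rule remove_variable)
  obtain n2 where n2: "m' = n2 + Poly_Mapping.single u 1" using u(2) by (rule remove_variable)
  have "n1 = n2"
  proof (rule Suc.hyps(1))
    show "n = monomial_degree n1" using Suc(2) n1 by (simp add: monomial_degree_add)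
    show "stair (Poly_Mapping.keys n1)" "stair (Poly_Mapping.keys n2)"
      using Suc.prems n1 n2 by (auto intro: stair_subset)
    show "toric_exponent n1 = toric_exponent n2"
      using Suc.prems(3) n1 n2 by (simp add: toric_exponent_add)
  qed
  then show ?case using n1 n2 by simp
qed

text \<open>The relation is kept abstract so that termination can be argued on exponents alone;
  congruence modulo the ideal is substituted later.\<close>

lemma straighten:
  assumes refl: "\<And>m. R m m" and trans: "\<And>m m' m''. R m m' \<Longrightarrow> R m' m'' \<Longrightarrow> R m m''"
    and swap: "\<And>m u v. \<lbrakk>Poly_Mapping.keys m \<subseteq> V; u \<in> V; v \<in> V; crossing u v\<rbrakk> \<Longrightarrow>
      R (m + Poly_Mapping.single u 1 + Poly_Mapping.single v 1)
        (m + Poly_Mapping.single (fst u, snd v) 1 + Poly_Mapping.single (fst v, snd u) (1 :: nat))"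
    and "Poly_Mapping.keys m \<subseteq> V"
  shows "\<exists>m'. R m m' \<and> stair (Poly_Mapping.keys m') \<and> monomial_degree m' = monomial_degree m"
proof -
  \<comment> \<open>Termination measure: replacing a crossing pair by the other diagonal lowers it
    by the product of the two rank gaps.\<close>
  define \<Phi> where "\<Phi> m = (\<Sum>v\<in>Poly_Mapping.keys m. Poly_Mapping.lookup m v * (\<gamma> (fst v) * \<rho> (snd v)))"
    for m :: "(int \<times> int) \<Rightarrow>\<^sub>0 nat"
  have \<Phi>_add: "\<Phi> (m + m') = \<Phi> m + \<Phi> m'" for m m'
    unfolding \<Phi>_def by (rule setsum_keys_plus_distrib) (auto simp: algebra_simps)
  have \<Phi>_single: "\<Phi> (Poly_Mapping.single v 1) = \<gamma> (fst v) * \<rho> (snd v)" for v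
    by (simp add: \<Phi>_def)
  show ?thesis
    using assms(4)
  proof (induction "\<Phi> m" arbitrary: m rule: less_induct)
    case less
    show ?case
    proof (cases "stair (Poly_Mapping.keys m)")
      case True
      then show ?thesis using refl by blast
    next
      case False
      then obtain u v where uv: "u \<in> Poly_Mapping.keys m" "v \<in> Poly_Mapping.keys m" "crossing u v"
        using less.prems unfolding stair_def by blast
      have V: "u \<in> V" "v \<in> V" using uv less.prems by auto
      have "u \<noteq> v" using uv(3) by (auto simp: crossing_def)
      obtain m1 where m1: "m = m1 + Poly_Mapping.single v 1" using uv(2) by (rule remove_variable)
      have "u \<in> Poly_Mapping.keys m1" using uv(1) \<open>u \<noteq> v\<close> m1 by simp
      then obtain m0 where m0: "m1 = m0 + Poly_Mapping.single u 1" by (rule remove_variable)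
      let ?m = "m0 + Poly_Mapping.single (fst u, snd v) 1 + Poly_Mapping.single (fst v, snd u) (1 :: nat)"
      have m: "m = m0 + Poly_Mapping.single u 1 + Poly_Mapping.single v 1" using m1 m0 by simp
      have keys: "Poly_Mapping.keys m0 \<subseteq> V" using less.prems m by simp
      obtain p where p: "0 < p" "\<gamma> (fst u) + p = \<gamma> (fst v)"
        using uv(3) less_imp_add_positive unfolding crossing_def by blast
      obtain q where q: "0 < q" "\<rho> (snd u) + q = \<rho> (snd v)"
        using uv(3) less_imp_add_positive unfolding crossing_def by blast
      have "\<Phi> ?m < \<Phi> m"
        unfolding m \<Phi>_add \<Phi>_single fst_conv snd_conv p(2)[symmetric] q(2)[symmetric]
        using p(1) q(1) by (simp add: algebra_simps)
      moreover have "Poly_Mapping.keys ?m \<subseteq> V" using keys crossing_corners[OF V uv(3)] by simp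
      ultimately obtain m' where m': "R ?m m'" "stair (Poly_Mapping.keys m')"
        "monomial_degree m' = monomial_degree ?m" using less.hyps[of ?m] by blast
      have "R m ?m" unfolding m by (rule swap[OF keys V uv(3)])
      moreover have "monomial_degree ?m = monomial_degree m"
        unfolding m by (simp add: monomial_degree_add)
      ultimately show ?thesis using trans[OF _ m'(1)] m'(2,3) by auto
    qed
  qed
qed

end

subsection \<open>The coordinate ring\<close>

lemma carrier_polynomial_ring:
  "p \<in> carrier (polynomial_ring X) \<longleftrightarrow> (\<forall>m\<in>Poly_Mapping.keys p. Poly_Mapping.keys m \<subseteq> vertex_set X)"
  by (simp add: polynomial_ring_def)

lemma polynomial_ring_simps [simp]:
  "p \<otimes>\<^bsub>polynomial_ring X\<^esub> q = p * q" "p \<oplus>\<^bsub>polynomial_ring X\<^esub> q = p + q"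
  "\<one>\<^bsub>polynomial_ring X\<^esub> = 1" "\<zero>\<^bsub>polynomial_ring X\<^esub> = 0"
  by (simp_all add: polynomial_ring_def)

lemma polynomial_ring_closed [simp, intro]:
  fixes p q :: "'k::field mpolynomial"
  shows "0 \<in> carrier (polynomial_ring X)" "1 \<in> carrier (polynomial_ring X)"
    "const c \<in> carrier (polynomial_ring X)"
    "p \<in> carrier (polynomial_ring X) \<Longrightarrow> q \<in> carrier (polynomial_ring X) \<Longrightarrow> p + q \<in> carrier (polynomial_ring X)"
    "p \<in> carrier (polynomial_ring X) \<Longrightarrow> q \<in> carrier (polynomial_ring X) \<Longrightarrow> p * q \<in> carrier (polynomial_ring X)"
    "p \<in> carrier (polynomial_ring X) \<Longrightarrow> - p \<in> carrier (polynomial_ring X)"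
    "p \<in> carrier (polynomial_ring X) \<Longrightarrow> q \<in> carrier (polynomial_ring X) \<Longrightarrow> p - q \<in> carrier (polynomial_ring X)"
proof -
  show "0 \<in> carrier (polynomial_ring X)" "1 \<in> carrier (polynomial_ring X)"
    "const c \<in> carrier (polynomial_ring X)"
    by (auto simp: carrier_polynomial_ring const_def)
  show add: "p + q \<in> carrier (polynomial_ring X)"
    if "p \<in> carrier (polynomial_ring X)" "q \<in> carrier (polynomial_ring X)" for p q :: "'k mpolynomial"
    using that keys_add[of p q] unfolding carrier_polynomial_ring by blast
  show minus: "- p \<in> carrier (polynomial_ring X)"
    if "p \<in> carrier (polynomial_ring X)" for p :: "'k mpolynomial"
    using that by (simp add: carrier_polynomial_ring in_keys_iff)
  show "p - q \<in> carrier (polynomial_ring X)"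
    if "p \<in> carrier (polynomial_ring X)" "q \<in> carrier (polynomial_ring X)"
    using add[OF that(1) minus[OF that(2)]] by simp
  show "p * q \<in> carrier (polynomial_ring X)"
    if "p \<in> carrier (polynomial_ring X)" "q \<in> carrier (polynomial_ring X)"
    using that keys_mult[of p q] unfolding carrier_polynomial_ring by (fastforce simp: keys_add_nat)
qed

lemma single_carrier:
  "Poly_Mapping.keys m \<subseteq> vertex_set X \<Longrightarrow> Poly_Mapping.single m c \<in> carrier (polynomial_ring X)"
  by (auto simp: carrier_polynomial_ring)

lemma var_carrier [intro]: "v \<in> vertex_set X \<Longrightarrow> var v \<in> carrier (polynomial_ring X)"
  by (simp add: var_def single_carrier)

lemma cring_polynomial_ring: "cring (polynomial_ring X :: 'k::field mpolynomial ring)"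
proof (rule cringI)
  show "abelian_group (polynomial_ring X :: 'k mpolynomial ring)"
  proof (rule abelian_groupI)
    fix p :: "'k mpolynomial"
    assume "p \<in> carrier (polynomial_ring X)"
    then show "\<exists>q\<in>carrier (polynomial_ring X). q \<oplus>\<^bsub>polynomial_ring X\<^esub> p = \<zero>\<^bsub>polynomial_ring X\<^esub>"
      by (intro bexI[of _ "- p"]) auto
  qed (auto simp: algebra_simps)
  show "comm_monoid (polynomial_ring X :: 'k mpolynomial ring)"
    by (rule comm_monoidI) (auto simp: algebra_simps)
qed (auto simp: algebra_simps)

lemma a_inv_polynomial_ring:
  assumes "p \<in> carrier (polynomial_ring X)"
  shows "\<ominus>\<^bsub>polynomial_ring X\<^esub> p = - p"
proof -
  interpret cring "polynomial_ring X" by (rule cring_polynomial_ring)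
  show ?thesis using minus_equality[of "- p" p] assms by simp
qed

lemma a_minus_polynomial_ring:
  assumes "p \<in> carrier (polynomial_ring X)" "q \<in> carrier (polynomial_ring X)"
  shows "p \<ominus>\<^bsub>polynomial_ring X\<^esub> q = p - q"
  using assms by (simp add: a_minus_def a_inv_polynomial_ring)

lemma inner_binomials_carrier: "inner_binomials X \<subseteq> carrier (polynomial_ring X)"
  unfolding inner_binomials_def by auto

lemma polyomino_ideal_ideal: "ideal (polyomino_ideal X) (polynomial_ring X)"
  unfolding polyomino_ideal_def
  by (rule ring.genideal_ideal[OF cring.axioms(1)[OF cring_polynomial_ring] inner_binomials_carrier])

lemma polyomino_ideal_closed:
  fixes p q :: "'k::field mpolynomial"
  shows "(0 :: 'k mpolynomial) \<in> polyomino_ideal X"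
    and "p \<in> polyomino_ideal X \<Longrightarrow> q \<in> polyomino_ideal X \<Longrightarrow> p + q \<in> polyomino_ideal X"
    and "p \<in> polyomino_ideal X \<Longrightarrow> - p \<in> polyomino_ideal X"
    and "p \<in> polyomino_ideal X \<Longrightarrow> q \<in> carrier (polynomial_ring X) \<Longrightarrow> q * p \<in> polyomino_ideal X"
proof -
  interpret ideal "polyomino_ideal X" "polynomial_ring X :: 'k mpolynomial ring"
    by (rule polyomino_ideal_ideal)
  show "(0 :: 'k mpolynomial) \<in> polyomino_ideal X"
    and "p \<in> polyomino_ideal X \<Longrightarrow> q \<in> polyomino_ideal X \<Longrightarrow> p + q \<in> polyomino_ideal X"
    and "p \<in> polyomino_ideal X \<Longrightarrow> q \<in> carrier (polynomial_ring X) \<Longrightarrow> q * p \<in> polyomino_ideal X"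
    using additive_subgroup.zero_closed[OF additive_subgroup_axioms]
      additive_subgroup.a_closed[OF additive_subgroup_axioms] I_l_closed by simp_all
  show "p \<in> polyomino_ideal X \<Longrightarrow> - p \<in> polyomino_ideal X"
    using additive_subgroup.a_inv_closed[OF additive_subgroup_axioms, of p] a_inv_polynomial_ring[of p X] Icarr[of p] by simp
qed

text \<open>The generators assume \<open>a \<le> b\<close> in the plane, whereas crossing pairs are
  ordered by rank. Reversing one coordinate negates the binomial, reversing both fixes it.\<close>

lemma binomial_in_polyomino_ideal:
  assumes "{(a, b), (a', b'), (a, b'), (a', b)} \<subseteq> vertex_set X"
  shows "var (a, b) * var (a', b') - var (a, b') * var (a', b) \<in> polyomino_ideal X"
proof -
  have gen: "var (a, b) * var (a', b') - var (a, b') * var (a', b) \<in> polyomino_ideal X"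
    if "{(a, b), (a', b'), (a, b'), (a', b)} \<subseteq> vertex_set X" "a \<le> a'" "b \<le> b'" for a a' b b'
  proof -
    have "var (a, b) * var (a', b') - var (a, b') * var (a', b) \<in> inner_binomials X"
      unfolding inner_binomials_def mem_Collect_eq
      by (rule exI[of _ "(a, b)"], rule exI[of _ "(a', b')"], rule exI[of _ "(a, b')"],
          rule exI[of _ "(a', b)"]) (use that in \<open>auto simp: less_eq_prod_def\<close>)
    then show ?thesis
      using ring.genideal_self[OF cring.axioms(1)[OF cring_polynomial_ring] inner_binomials_carrier]
      unfolding polyomino_ideal_def by blast
  qed
  consider "a \<le> a'" "b \<le> b'" | "a \<le> a'" "b' \<le> b" | "a' \<le> a" "b \<le> b'" | "a' \<le> a" "b' \<le> b"
    by linarith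
  then show ?thesis
  proof cases
    case 1
    then show ?thesis using gen assms by blast
  next
    case 2
    then show ?thesis using polyomino_ideal_closed(3)[OF gen[of a b' a' b]] assms by auto
  next
    case 3
    then show ?thesis using polyomino_ideal_closed(3)[OF gen[of a' b a b']] assms
      by (auto simp: mult.commute)
  next
    case 4
    then show ?thesis using gen[of a' b' a b] assms by (auto simp: mult.commute)
  qed
qed

lemma residue_class_hom:
  "ring_hom_ring (polynomial_ring X) (coordinate_ring X) (residue_class X :: 'k::field mpolynomial \<Rightarrow> _)"
proof -
  have "(residue_class X :: 'k mpolynomial \<Rightarrow> _) = (\<lambda>p. polyomino_ideal X +>\<^bsub>polynomial_ring X\<^esub> p)"
    by (simp add: fun_eq_iff residue_class_def)
  then show ?thesis
    unfolding coordinate_ring_def using ideal.rcos_ring_hom_ring[OF polyomino_ideal_ideal] by simp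
qed

lemma residue_class_eq_iff:
  assumes "p \<in> carrier (polynomial_ring X)" "q \<in> carrier (polynomial_ring X)"
  shows "residue_class X p = residue_class X q \<longleftrightarrow> p - q \<in> polyomino_ideal X"
  using ring.quotient_eq_iff_same_a_r_cos[OF cring.axioms(1)[OF cring_polynomial_ring]
      polyomino_ideal_ideal assms] a_minus_polynomial_ring[OF assms]
  unfolding residue_class_def by simp

lemma zero_coordinate_ring: "\<zero>\<^bsub>coordinate_ring X\<^esub> = residue_class X (0 :: 'k::field mpolynomial)"
proof -
  interpret ring_hom_ring "polynomial_ring X" "coordinate_ring X" "residue_class X :: 'k mpolynomial \<Rightarrow> _"
    by (rule residue_class_hom)
  show ?thesis using hom_zero by simp
qed

lemma residue_class_eq_0_iff:
  assumes "p \<in> carrier (polynomial_ring X)"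
  shows "residue_class X p = \<zero>\<^bsub>coordinate_ring X\<^esub> \<longleftrightarrow> p \<in> polyomino_ideal X"
  using residue_class_eq_iff[OF assms, of 0] by (simp add: zero_coordinate_ring)

lemma carrier_coordinate_ring:
  "carrier (coordinate_ring X) = residue_class X ` carrier (polynomial_ring X)"
  unfolding coordinate_ring_def FactRing_def residue_class_def by (auto simp: A_RCOSETS_def')

lemma cring_coordinate_ring: "cring (coordinate_ring X)"
  unfolding coordinate_ring_def
  by (rule ideal.quotient_is_cring[OF polyomino_ideal_ideal cring_polynomial_ring])

section \<open>Prime ideals from faces\<close>

definition toric_kernel :: "(real \<times> real) set \<Rightarrow> (int \<times> int) set \<Rightarrow> 'k::field mpolynomial set" where
  "toric_kernel X F = {p \<in> carrier (polynomial_ring X). toric_eval F p = 0}"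

lemma toric_kernel_prime: "primeideal (toric_kernel X F) (polynomial_ring X :: 'k::field mpolynomial ring)"
proof (rule primeidealI2)
  let ?R = "polynomial_ring X :: 'k mpolynomial ring"
  interpret cring ?R by (rule cring_polynomial_ring)
  show "cring ?R" by (rule cring_polynomial_ring)
  show "additive_subgroup (toric_kernel X F) ?R"
    by (rule additive_subgroup.intro, rule add.subgroupI)
      (auto simp: toric_kernel_def toric_eval_add toric_eval_uminus a_inv_polynomial_ring
        simp flip: a_inv_def intro: exI[of _ 0])
  show "carrier ?R \<noteq> toric_kernel X F"
  proof
    assume "carrier ?R = toric_kernel X F"
    then have "1 \<in> (toric_kernel X F :: 'k mpolynomial set)" by (metis polynomial_ring_closed(2))
    then show False by (simp add: toric_kernel_def toric_eval_1)
  qed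
qed (auto simp: toric_kernel_def toric_eval_mult)

text \<open>The condition of \<open>toric_eval_binomial\<close> imposed on all generators at
  once.\<close>

definition face :: "(int \<times> int) set \<Rightarrow> (int \<times> int) set \<Rightarrow> bool" where
  "face V F \<longleftrightarrow> (\<forall>a b a' b'. {(a, b), (a', b'), (a, b'), (a', b)} \<subseteq> V \<longrightarrow>
     ((a, b) \<in> F \<and> (a', b') \<in> F \<longleftrightarrow> (a, b') \<in> F \<and> (a', b) \<in> F))"

lemma polyomino_ideal_subset_toric_kernel:
  assumes "face (vertex_set X) F"
  shows "polyomino_ideal X \<subseteq> (toric_kernel X F :: 'k::field mpolynomial set)"
  unfolding polyomino_ideal_def
proof (rule ring.genideal_minimal[OF cring.axioms(1)[OF cring_polynomial_ring]])
  show "ideal (toric_kernel X F) (polynomial_ring X :: 'k mpolynomial ring)"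
    using toric_kernel_prime primeideal.axioms(1) by blast
  show "inner_binomials X \<subseteq> (toric_kernel X F :: 'k mpolynomial set)"
  proof
    fix p :: "'k mpolynomial" assume p: "p \<in> inner_binomials X"
    then obtain a b a' b' where ab: "{(a, b), (a', b'), (a, b'), (a', b)} \<subseteq> vertex_set X"
      "p = var (a, b) * var (a', b') - var (a, b') * var (a', b)"
      unfolding inner_binomials_def by force
    then have "toric_eval F p = 0"
      using assms toric_eval_binomial unfolding face_def by meson
    then show "p \<in> toric_kernel X F"
      using p inner_binomials_carrier by (auto simp: toric_kernel_def)
  qed
qed

lemma residue_class_mem_image_iff:
  assumes "polyomino_ideal X \<subseteq> J" "\<And>p q. p \<in> J \<Longrightarrow> q \<in> J \<Longrightarrow> p + q \<in> J"
    "J \<subseteq> carrier (polynomial_ring X)" "p \<in> carrier (polynomial_ring X)"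
  shows "residue_class X p \<in> residue_class X ` J \<longleftrightarrow> p \<in> J"
proof
  assume "residue_class X p \<in> residue_class X ` J"
  then obtain q where q: "q \<in> J" "residue_class X p = residue_class X q" by auto
  then have "p - q \<in> J" using residue_class_eq_iff[of p X q] assms(1,3,4) by blast
  then show "p \<in> J" using assms(2)[OF _ q(1)] by fastforce
qed auto

lemma residue_class_mem_toric_kernel_iff:
  assumes "face (vertex_set X) F" "p \<in> carrier (polynomial_ring X)"
  shows "residue_class X p \<in> residue_class X ` toric_kernel X F \<longleftrightarrow> toric_eval F p = 0"
  using residue_class_mem_image_iff[OF polyomino_ideal_subset_toric_kernel[OF assms(1)] _ _ assms(2)] assms(2)
  by (auto simp: toric_kernel_def toric_eval_add)

lemma toric_kernel_image_prime:
  assumes F: "face (vertex_set X) F"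
  shows "primeideal (residue_class X ` (toric_kernel X F :: 'k::field mpolynomial set)) (coordinate_ring X)"
proof (rule primeidealI)
  let ?K = "toric_kernel X F :: 'k mpolynomial set"
  note mem = residue_class_mem_toric_kernel_iff[OF F]
  interpret hom: ring_hom_ring "polynomial_ring X" "coordinate_ring X" "residue_class X :: 'k mpolynomial \<Rightarrow> _"
    by (rule residue_class_hom)
  have "residue_class X ` ?K = (+>\<^bsub>polynomial_ring X\<^esub>) (polyomino_ideal X) ` ?K"
    by (simp add: residue_class_def)
  then show "ideal (residue_class X ` ?K) (coordinate_ring X)"
    unfolding coordinate_ring_def
    using ring.ring_ideal_imp_quot_ideal[OF cring.axioms(1)[OF cring_polynomial_ring]
        polyomino_ideal_ideal primeideal.axioms(1)[OF toric_kernel_prime]] by simp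
  show "cring (coordinate_ring X :: 'k mpolynomial set ring)" by (rule cring_coordinate_ring)
  have "residue_class X 1 \<notin> residue_class X ` ?K" by (subst mem) (auto simp: toric_eval_1)
  moreover have "residue_class X (1 :: 'k mpolynomial) \<in> carrier (coordinate_ring X)"
    unfolding carrier_coordinate_ring by auto
  ultimately show "carrier (coordinate_ring X) \<noteq> residue_class X ` ?K" by blast
  fix a b
  assume "a \<in> carrier (coordinate_ring X)" "b \<in> carrier (coordinate_ring X)"
    and ab: "a \<otimes>\<^bsub>coordinate_ring X\<^esub> b \<in> residue_class X ` ?K"
  then obtain p q where p: "p \<in> carrier (polynomial_ring X)" "a = residue_class X p"
    and q: "q \<in> carrier (polynomial_ring X)" "b = residue_class X q"
    unfolding carrier_coordinate_ring by auto
  have "residue_class X (p * q) \<in> residue_class X ` ?K"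
    using ab hom.hom_mult[OF p(1) q(1)] by (simp add: p q)
  then have "toric_eval F (p * q) = 0" using p q by (simp add: mem)
  then show "a \<in> residue_class X ` ?K \<or> b \<in> residue_class X ` ?K"
    using p q by (simp add: mem toric_eval_mult)
qed

lemma coordinate_ring_nontrivial: "\<one>\<^bsub>coordinate_ring X\<^esub> \<noteq> \<zero>\<^bsub>coordinate_ring X :: 'k::field mpolynomial set ring\<^esub>"
proof -
  interpret hom: ring_hom_ring "polynomial_ring X" "coordinate_ring X" "residue_class X :: 'k mpolynomial \<Rightarrow> _"
    by (rule residue_class_hom)
  \<comment> \<open>On the empty face \<open>toric_eval\<close> keeps only the constant term: it
    kills every generator but not 1.\<close>
  have "(1 :: 'k mpolynomial) \<notin> polyomino_ideal X"
    using polyomino_ideal_subset_toric_kernel[of X "{}", where ?'k = 'k] toric_eval_1[of "{}", where ?'a = 'k]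
    by (auto simp: face_def toric_kernel_def)
  then have "residue_class X (1 :: 'k mpolynomial) \<noteq> \<zero>\<^bsub>coordinate_ring X\<^esub>"
    by (subst residue_class_eq_0_iff) auto
  then show ?thesis using hom.hom_one by simp
qed

text \<open>\<open>K\<close> packages the type \<open>'k\<close> as a ring with a carrier; its image
  under a homomorphism into a nontrivial ring is a subfield.\<close>

lemma subfield_scalars: "subfield (scalars X) (coordinate_ring X :: 'k::field mpolynomial set ring)"
proof -
  define K :: "'k ring" where "K = \<lparr>carrier = UNIV, mult = (*), one = 1, zero = 0, add = (+)\<rparr>"
  have [simp]: "carrier K = UNIV" "mult K = (*)" "one K = 1" "zero K = 0" "add K = (+)"
    by (simp_all add: K_def)
  have "cring K"
    by (rule cringI, rule abelian_groupI)
      (auto simp: algebra_simps intro: comm_monoidI exI[of _ "- _ :: 'k"])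
  then interpret K: cring K .
  have "field K"
  proof (rule K.cring_fieldI2)
    fix a assume "a \<in> carrier K" "a \<noteq> \<zero>\<^bsub>K\<^esub>"
    then show "\<exists>b\<in>carrier K. a \<otimes>\<^bsub>K\<^esub> b = \<one>\<^bsub>K\<^esub>" by (auto intro: exI[of _ "inverse a"])
  qed simp
  have hom: "ring_hom_ring K (polynomial_ring X) const"
    by (rule ring_hom_ringI[OF K.ring_axioms cring.axioms(1)[OF cring_polynomial_ring]])
      (auto simp: const_def mult_single single_add single_carrier)
  have "residue_class X \<circ> const \<in> ring_hom K (coordinate_ring X)"
    using ring_hom_trans[OF ring_hom_ring.homh[OF hom] ring_hom_ring.homh[OF residue_class_hom]] .
  then have "ring_hom_ring K (coordinate_ring X) (residue_class X \<circ> const)"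
    by (rule ring_hom_ringI2[OF K.ring_axioms cring.axioms(1)[OF cring_coordinate_ring]])
  then have "subfield ((residue_class X \<circ> const) ` carrier K) (coordinate_ring X)"
    using ring_hom_ring.img_is_subfield(2) field.carrier_is_subfield[OF \<open>field K\<close>] coordinate_ring_nontrivial
    by blast
  then show ?thesis by (simp add: scalars_def image_comp)
qed

lemma residue_class_carrier [intro, simp]:
  "p \<in> carrier (polynomial_ring X) \<Longrightarrow> residue_class X p \<in> carrier (coordinate_ring X)"
  unfolding carrier_coordinate_ring by auto

text \<open>\<open>combine\<close> stops at the end of the shorter list, as \<open>zip\<close> does.
  The carrier statement is proved along because the induction step needs it for additivity.\<close>

lemma combine_residue_class:
  fixes cs :: "'k::field list"
  assumes "\<And>m. m \<in> set ms \<Longrightarrow> Poly_Mapping.keys m \<subseteq> vertex_set X"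
  shows "ring.combine (coordinate_ring X) (map (\<lambda>c. residue_class X (const c)) cs)
      (map (\<lambda>m. residue_class X (Poly_Mapping.single m 1)) ms) =
    residue_class X (\<Sum>(c, m)\<leftarrow>zip cs ms. Poly_Mapping.single m c)
    \<and> (\<Sum>(c, m)\<leftarrow>zip cs ms. Poly_Mapping.single m c) \<in> carrier (polynomial_ring X)"
proof -
  interpret A: cring "coordinate_ring X :: 'k mpolynomial set ring" by (rule cring_coordinate_ring)
  interpret hom: ring_hom_ring "polynomial_ring X" "coordinate_ring X" "residue_class X :: 'k mpolynomial \<Rightarrow> _"
    by (rule residue_class_hom)
  show ?thesis
    using assms
  proof (induction cs ms rule: list_induct2')
    case (4 c cs m ms)
    then have m: "Poly_Mapping.single m c \<in> carrier (polynomial_ring X)" for c :: 'k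
      by (intro single_carrier) auto
    let ?p = "\<Sum>(c, m)\<leftarrow>zip cs ms. Poly_Mapping.single m c"
    have IH: "A.combine (map (\<lambda>c. residue_class X (const c)) cs)
      (map (\<lambda>m. residue_class X (Poly_Mapping.single m 1)) ms) = residue_class X ?p"
      "?p \<in> carrier (polynomial_ring X)" using 4 by auto
    have "residue_class X (const c) \<otimes>\<^bsub>coordinate_ring X\<^esub> residue_class X (Poly_Mapping.single m 1) =
        residue_class X (Poly_Mapping.single m c)"
      using hom.hom_mult[OF polynomial_ring_closed(3)[of c X] m[of 1]] by (simp add: const_def mult_single)
    then show ?case using IH m hom.hom_add[of "Poly_Mapping.single m c" ?p] by auto
  qed (auto simp: zero_coordinate_ring)
qed

section \<open>Bases of the graded pieces\<close>

lemma finite_monomials: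
  assumes "finite V"
  shows "finite {m. Poly_Mapping.keys m \<subseteq> V \<and> monomial_degree m = n}"
proof (induction n)
  case 0
  have "{m. Poly_Mapping.keys m \<subseteq> V \<and> monomial_degree m = 0} \<subseteq> {0}" by auto
  then show ?case using finite_subset by blast
next
  case (Suc n)
  let ?M = "{m. Poly_Mapping.keys m \<subseteq> V \<and> monomial_degree m = n}"
  have "{m. Poly_Mapping.keys m \<subseteq> V \<and> monomial_degree m = Suc n} \<subseteq>
      (\<Union>v\<in>V. (\<lambda>m. m + Poly_Mapping.single v 1) ` ?M)"
  proof
    fix m assume m: "m \<in> {m. Poly_Mapping.keys m \<subseteq> V \<and> monomial_degree m = Suc n}"
    then have "m \<noteq> 0" by auto
    then obtain v where v: "v \<in> Poly_Mapping.keys m" by (metis all_not_in_conv keys_eq_empty)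
    obtain m' where m': "m = m' + Poly_Mapping.single v 1" using v by (rule remove_variable)
    then have "m' \<in> ?M" using m by (auto simp: monomial_degree_add)
    then show "m \<in> (\<Union>v\<in>V. (\<lambda>m. m + Poly_Mapping.single v 1) ` ?M)"
      using m m' v by blast
  qed
  then show ?case using Suc assms by (auto intro: finite_subset)
qed

context ranked_tableau
begin

definition stair_monomials :: "nat \<Rightarrow> ((int \<times> int) \<Rightarrow>\<^sub>0 nat) set" where
  "stair_monomials n = {m. stair (Poly_Mapping.keys m) \<and> monomial_degree m = n}"

lemma finite_stair_monomials: "finite (stair_monomials n)"
  by (rule finite_subset[OF _ finite_monomials[OF finite_V, of n]])
     (auto simp: stair_monomials_def stair_def)

lemma monomial_straighten:
  assumes X: "vertex_set X = V" and m: "Poly_Mapping.keys m \<subseteq> V"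
  obtains m' where "m' \<in> stair_monomials (monomial_degree m)"
    "residue_class X (Poly_Mapping.single m (1 :: 'k::field)) = residue_class X (Poly_Mapping.single m' 1)"
proof -
  define R where "R m m' \<longleftrightarrow> Poly_Mapping.single m (1 :: 'k) - Poly_Mapping.single m' 1 \<in> polyomino_ideal X"
    for m m' :: "(int \<times> int) \<Rightarrow>\<^sub>0 nat"
  have "\<exists>m'. R m m' \<and> stair (Poly_Mapping.keys m') \<and> monomial_degree m' = monomial_degree m"
  proof (rule straighten[OF _ _ _ m])
    show "R m m" for m by (simp add: R_def polyomino_ideal_closed)
    show "R m m''" if "R m m'" "R m' m''" for m m' m''
      using polyomino_ideal_closed(2)[OF that[unfolded R_def]] by (simp add: R_def)
    fix m :: "(int \<times> int) \<Rightarrow>\<^sub>0 nat" and u v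
    assume m: "Poly_Mapping.keys m \<subseteq> V" and uv: "u \<in> V" "v \<in> V" "crossing u v"
    have "{(fst u, snd u), (fst v, snd v), (fst u, snd v), (fst v, snd u)} \<subseteq> vertex_set X"
      using uv crossing_corners[OF uv] X by auto
    then have "Poly_Mapping.single m (1 :: 'k) * (var (fst u, snd u) * var (fst v, snd v) - var (fst u, snd v) * var (fst v, snd u))
       \<in> polyomino_ideal X"
      by (intro polyomino_ideal_closed(4) single_carrier binomial_in_polyomino_ideal) (use m X in auto)
    then show "R (m + Poly_Mapping.single u 1 + Poly_Mapping.single v 1)
        (m + Poly_Mapping.single (fst u, snd v) 1 + Poly_Mapping.single (fst v, snd u) 1)"
      by (simp add: R_def var_def mult_single right_diff_distrib add.assoc)
  qed
  then obtain m' where m': "R m m'" "stair (Poly_Mapping.keys m')" "monomial_degree m' = monomial_degree m"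
    by blast
  then have "residue_class X (Poly_Mapping.single m (1 :: 'k)) = residue_class X (Poly_Mapping.single m' 1)"
    using m X by (subst residue_class_eq_iff) (auto simp: R_def stair_def intro!: single_carrier)
  then show ?thesis using that m' by (auto simp: stair_monomials_def)
qed

lemma dim_graded_piece:
  assumes X: "vertex_set X = V"
  shows "ring.dim (coordinate_ring X) (scalars X) (graded_piece X n :: 'k::field mpolynomial set set)
    = card (stair_monomials n)"
proof -
  let ?A = "coordinate_ring X :: 'k mpolynomial set ring"
  let ?K = "scalars X :: 'k mpolynomial set set"
  interpret A: cring ?A by (rule cring_coordinate_ring)
  interpret K: subfield ?K ?A by (rule subfield_scalars)
  interpret hom: ring_hom_ring "polynomial_ring X" ?A "residue_class X :: 'k mpolynomial \<Rightarrow> _"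
    by (rule residue_class_hom)
  obtain ms where ms: "set ms = stair_monomials n" "distinct ms"
    using finite_distinct_list[OF finite_stair_monomials] by blast
  have keys: "Poly_Mapping.keys m \<subseteq> vertex_set X" "stair (Poly_Mapping.keys m)" "monomial_degree m = n"
    if "m \<in> set ms" for m
    using that ms X by (auto simp: stair_monomials_def stair_def)
  define Us where "Us = map (\<lambda>m. residue_class X (Poly_Mapping.single m (1 :: 'k))) ms"
  have Us: "set Us \<subseteq> carrier ?A" using keys by (auto simp: Us_def single_carrier)
  have scalars: "\<exists>cs. Ks = map (\<lambda>c. residue_class X (const c)) cs" if "set Ks \<subseteq> ?K" for Ks
    using that
  proof (induction Ks)
    case (Cons k Ks)
    then obtain c cs where "k = residue_class X (const c)" "Ks = map (\<lambda>c. residue_class X (const c)) cs"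
      by (auto simp: scalars_def)
    then show ?case by (intro exI[of _ "c # cs"]) simp
  qed simp
  have "A.independent ?K Us"
  proof (rule A.trivial_combine_imp_independent[OF K.subfield_axioms Us])
    fix Ks assume Ks: "set Ks \<subseteq> ?K" "A.combine Ks Us = \<zero>\<^bsub>?A\<^esub>"
    obtain cs where cs: "Ks = map (\<lambda>c. residue_class X (const c)) cs" using scalars[OF Ks(1)] by blast
    let ?p = "\<Sum>(c, m)\<leftarrow>zip cs ms. Poly_Mapping.single m c"
    have "residue_class X ?p = \<zero>\<^bsub>?A\<^esub>" "?p \<in> carrier (polynomial_ring X)"
      using Ks(2) combine_residue_class[of ms X cs] keys(1) unfolding cs Us_def by auto
    then have "?p \<in> polyomino_ideal X" using residue_class_eq_0_iff by blast
    \<comment> \<open>With the whole of \<open>V\<close> as face nothing is projected away, and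
      \<open>toric_eval V\<close> is the full toric map.\<close>
    moreover have "face (vertex_set X) V" by (auto simp: face_def X)
    ultimately have ev: "toric_eval V ?p = 0"
      using polyomino_ideal_subset_toric_kernel[of X V] by (auto simp: toric_kernel_def)
    \<comment> \<open>The coefficient list may be longer or shorter than \<open>ms\<close>; only the
      common part enters the sum.\<close>
    define l where "l = min (length cs) (length ms)"
    have p: "?p = (\<Sum>i<l. Poly_Mapping.single (ms ! i) (cs ! i))"
      by (subst sum_list_sum_nth) (simp add: l_def atLeast0LessThan)
    \<comment> \<open>Distinct stair monomials have distinct toric exponents, so the coefficient at
      the exponent of \<open>ms ! j\<close> isolates \<open>cs ! j\<close>.\<close>
    have c0: "cs ! j = 0" if j: "j < l" for j
    proof -
      have "(\<Sum>i<l. Poly_Mapping.single (toric_exponent (ms ! i)) (cs ! i)) = 0"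
        using ev keys(1) X unfolding p toric_eval_sum toric_eval_single l_def by simp
      then have "0 = (\<Sum>i<l. Poly_Mapping.lookup (Poly_Mapping.single (toric_exponent (ms ! i)) (cs ! i)) (toric_exponent (ms ! j)))"
        by (simp flip: lookup_sum)
      also have "\<dots> = (\<Sum>i<l. if i = j then cs ! i else 0)"
      proof (rule sum.cong)
        fix i assume i: "i \<in> {..<l}"
        have "toric_exponent (ms ! i) = toric_exponent (ms ! j) \<longleftrightarrow> i = j"
          using toric_exponent_inj_on_stairs[of "ms ! i" "ms ! j"] keys(2) i j ms(2)
          by (auto simp: l_def nth_eq_iff_index_eq)
        then show "Poly_Mapping.lookup (Poly_Mapping.single (toric_exponent (ms ! i)) (cs ! i)) (toric_exponent (ms ! j))
          = (if i = j then cs ! i else 0)" by (simp add: lookup_single when_def)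
      qed simp
      also have "\<dots> = cs ! j" using j by simp
      finally show ?thesis by simp
    qed
    have "residue_class X (const 0) = \<zero>\<^bsub>?A\<^esub>" by (simp add: zero_coordinate_ring const_def)
    then show "set (take (length Us) Ks) \<subseteq> {\<zero>\<^bsub>?A\<^esub>}"
      using c0 by (auto simp: cs Us_def in_set_conv_nth l_def)
  qed
  moreover have "A.Span ?K Us = graded_piece X n"
  proof
    show "A.Span ?K Us \<subseteq> graded_piece X n"
    proof
      fix x assume "x \<in> A.Span ?K Us"
      then obtain Ks where Ks: "set Ks \<subseteq> ?K" "x = A.combine Ks Us"
        using A.Span_eq_combine_set[OF K.subfield_axioms Us] by auto
      obtain cs where cs: "Ks = map (\<lambda>c. residue_class X (const c)) cs" using scalars[OF Ks(1)] by blast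
      let ?p = "\<Sum>(c, m)\<leftarrow>zip cs ms. Poly_Mapping.single m c"
      have x: "x = residue_class X ?p" "?p \<in> carrier (polynomial_ring X)"
        using Ks(2) combine_residue_class[of ms X cs] keys(1) unfolding cs Us_def by auto
      have "Poly_Mapping.keys (\<Sum>(c, m)\<leftarrow>xs. Poly_Mapping.single m c) \<subseteq> snd ` set xs"
        for xs :: "('k \<times> ((int \<times> int) \<Rightarrow>\<^sub>0 nat)) list"
        by (induction xs) (use keys_add in \<open>fastforce split: if_splits\<close>)+
      then have "Poly_Mapping.keys ?p \<subseteq> set ms" by (force dest: set_zip_rightD)
      then show "x \<in> graded_piece X n" using x keys(3) unfolding graded_piece_def by blast
    qed
    show "graded_piece X n \<subseteq> A.Span ?K Us"
    proof
      fix x :: "'k mpolynomial set" assume "x \<in> graded_piece X n"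
      then obtain p where p: "x = residue_class X p" "p \<in> carrier (polynomial_ring X)"
        "\<And>m. m \<in> Poly_Mapping.keys p \<Longrightarrow> monomial_degree m = n" unfolding graded_piece_def by auto
      have single: "residue_class X (Poly_Mapping.single m c) \<in> A.Span ?K Us"
        if m: "m \<in> Poly_Mapping.keys p" for m and c :: 'k
      proof -
        have V: "Poly_Mapping.keys m \<subseteq> V" using p(2) m X unfolding carrier_polynomial_ring by blast
        obtain m' where m': "m' \<in> stair_monomials (monomial_degree m)"
          "residue_class X (Poly_Mapping.single m (1 :: 'k)) = residue_class X (Poly_Mapping.single m' 1)"
          using monomial_straighten[OF X V] .
        then have "m' \<in> set ms" using ms p(3)[OF m] by simp
        then have "residue_class X (Poly_Mapping.single m 1) \<in> set Us" by (simp add: Us_def m'(2))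
        then have "residue_class X (const c) \<otimes>\<^bsub>?A\<^esub> residue_class X (Poly_Mapping.single m 1) \<in> A.Span ?K Us"
          using A.Span_base_incl[OF K.subfield_axioms Us]
          by (intro A.Span_smult_closed[OF K.subfield_axioms Us]) (auto simp: scalars_def)
        then show ?thesis
          using hom.hom_mult[OF polynomial_ring_closed(3)[of c X] single_carrier[of m X 1]] V X
          by (simp add: const_def mult_single)
      qed
      have "residue_class X (\<Sum>m\<in>M. Poly_Mapping.single m (Poly_Mapping.lookup p m)) \<in> A.Span ?K Us
          \<and> (\<Sum>m\<in>M. Poly_Mapping.single m (Poly_Mapping.lookup p m)) \<in> carrier (polynomial_ring X)"
        if "M \<subseteq> Poly_Mapping.keys p" for M
        using finite_subset[OF that finite_keys] that
      proof (induction M rule: finite_induct)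
        case empty
        then show ?case
          using A.Span_subgroup_props(2)[OF K.subfield_axioms Us] by (simp add: zero_coordinate_ring)
      next
        case (insert m M)
        let ?s = "Poly_Mapping.single m (Poly_Mapping.lookup p m)"
        have s: "?s \<in> carrier (polynomial_ring X)"
          using insert p(2) unfolding carrier_polynomial_ring by auto
        show ?case
          using insert single A.Span_subgroup_props(3)[OF K.subfield_axioms Us] s hom.hom_add[OF s] by auto
      qed
      then show "x \<in> A.Span ?K Us"
        using poly_mapping_sum_single[of p] p(1) by (metis order_refl)
    qed
  qed
  ultimately have "A.dimension (length Us) ?K (graded_piece X n)"
    using A.dimensionI[OF K.subfield_axioms] by blast
  then show ?thesis
    using A.dimI[OF K.subfield_axioms] distinct_card[OF ms(2)] ms(1) by (auto simp: Us_def over_def)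
qed

end

subsection \<open>The Hilbert series\<close>

text \<open>Sorting basis monomials by exact support splits the Hilbert series over the stairs: a
  support \<open>F\<close> contributes \<open>(t / (1 - t))\<^sup>k\<close> with
  \<open>k = card F\<close>.\<close>

definition support_count :: "(int \<times> int) set \<Rightarrow> nat \<Rightarrow> nat" where
  "support_count F n = card {m. Poly_Mapping.keys m = F \<and> monomial_degree m = n}"

lemma finite_support_monomials:
  "finite F \<Longrightarrow> finite {m. Poly_Mapping.keys m = F \<and> monomial_degree m = n}"
  by (rule finite_subset[OF _ finite_monomials[of F n]]) auto

lemma support_count_0: "support_count F 0 = (if F = {} then 1 else 0)"
proof -
  have "{m. Poly_Mapping.keys m = F \<and> monomial_degree m = 0} = (if F = {} then {0} else {})"
    by auto
  then show ?thesis by (simp add: support_count_def)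
qed

lemma support_count_empty: "support_count {} (Suc n) = 0"
proof -
  have "{m. Poly_Mapping.keys m = {} \<and> monomial_degree m = Suc n} = {}" by auto
  then show ?thesis unfolding support_count_def by (metis card.empty)
qed

text \<open>Divide by \<open>v\<close> once; afterwards \<open>v\<close> may or may not still
  occur.\<close>

lemma support_count_insert:
  assumes "finite F" "v \<notin> F"
  shows "support_count (insert v F) (Suc n) = support_count F n + support_count (insert v F) n"
proof -
  let ?M = "\<lambda>F n. {m. Poly_Mapping.keys m = F \<and> monomial_degree m = n}"
  let ?f = "\<lambda>m. m + Poly_Mapping.single v (1 :: nat)"
  have "?f ` (?M F n \<union> ?M (insert v F) n) = ?M (insert v F) (Suc n)"
  proof
    show "?f ` (?M F n \<union> ?M (insert v F) n) \<subseteq> ?M (insert v F) (Suc n)"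
      by (rule image_subsetI) (elim UnE; clarsimp simp: monomial_degree_add)
    show "?M (insert v F) (Suc n) \<subseteq> ?f ` (?M F n \<union> ?M (insert v F) n)"
    proof
      fix m assume m: "m \<in> ?M (insert v F) (Suc n)"
      then have "v \<in> Poly_Mapping.keys m" by auto
      then obtain m' where m': "m = m' + Poly_Mapping.single v 1" by (rule remove_variable)
      then have "monomial_degree m' = n" "insert v (Poly_Mapping.keys m') = insert v F"
        using m by (auto simp: monomial_degree_add)
      moreover from this(2) have "Poly_Mapping.keys m' = F \<or> Poly_Mapping.keys m' = insert v F"
        using assms(2) by (metis insert_absorb insert_ident)
      ultimately show "m \<in> ?f ` (?M F n \<union> ?M (insert v F) n)" using m' by blast
    qed
  qed
  moreover have "inj_on ?f A" for A by (auto simp: inj_on_def)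
  ultimately have "card (?M (insert v F) (Suc n)) = card (?M F n \<union> ?M (insert v F) n)"
    by (metis (no_types, lifting) card_image)
  also have "\<dots> = card (?M F n) + card (?M (insert v F) n)"
    using assms by (intro card_Un_disjoint finite_support_monomials) auto
  finally show ?thesis by (simp add: support_count_def)
qed

lemma support_count_fps:
  assumes "finite F"
  shows "Abs_fps (\<lambda>n. int (support_count F n)) * (1 - fps_X) ^ card F = fps_X ^ card F"
  using assms
proof (induction F rule: finite_induct)
  case empty
  have "Abs_fps (\<lambda>n. int (support_count {} n)) = 1"
  proof (rule fps_ext)
    fix n show "fps_nth (Abs_fps (\<lambda>n. int (support_count {} n))) n = fps_nth 1 n"
      by (cases n) (auto simp: support_count_0 support_count_empty)
  qed
  then show ?case by simp
next
  case (insert v F)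
  let ?G = "\<lambda>F. Abs_fps (\<lambda>n. int (support_count F n))"
  have "?G (insert v F) * (1 - fps_X) = fps_X * ?G F"
  proof (rule fps_ext)
    fix n show "fps_nth (?G (insert v F) * (1 - fps_X)) n = fps_nth (fps_X * ?G F) n"
      using insert by (cases n) (auto simp: right_diff_distrib support_count_0 support_count_insert)
  qed
  then have "?G (insert v F) * (1 - fps_X) ^ card (insert v F) = fps_X * (?G F * (1 - fps_X) ^ card F)"
    using insert by (simp add: mult.assoc[symmetric])
  then show ?case using insert by simp
qed

lemma coeff_one_minus_X_power:
  "Polynomial.coeff ([:1, -1:] ^ e :: int poly) 0 = 1"
  "Polynomial.coeff ([:1, -1:] ^ e :: int poly) 1 = - int e"
  "2 * Polynomial.coeff ([:1, -1:] ^ e :: int poly) 2 = int e * (int e - 1)"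
proof -
  have "Polynomial.coeff ([:1, -1:] ^ e :: int poly) 0 = 1 \<and>
      Polynomial.coeff ([:1, -1:] ^ e :: int poly) 1 = - int e \<and>
      2 * Polynomial.coeff ([:1, -1:] ^ e :: int poly) 2 = int e * (int e - 1)"
  proof (induction e)
    case 0
    then show ?case by simp
  next
    case (Suc e)
    have "[:1, -1:] ^ Suc e = [:1, -1:] ^ e + pCons 0 (- ([:1, -1:] ^ e :: int poly))"
      by (simp add: algebra_simps)
    then show ?case using Suc by (simp add: numeral_2_eq_2 algebra_simps)
  qed
  then show "Polynomial.coeff ([:1, -1:] ^ e :: int poly) 0 = 1"
    "Polynomial.coeff ([:1, -1:] ^ e :: int poly) 1 = - int e"
    "2 * Polynomial.coeff ([:1, -1:] ^ e :: int poly) 2 = int e * (int e - 1)" by auto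
qed

section \<open>The h-polynomial as a sum over stairs\<close>

context ranked_tableau
begin

text \<open>The classical passage from face numbers to the numerator over
  \<open>(1 - t)\<^sup>d\<close>, with \<open>d\<close> as a parameter because the dimension is only
  known up to bounds. The subtraction \<open>d - card F\<close> truncates, so
  \<open>hilbert_series_stairs\<close> requires \<open>d\<close> to be at least the size of every
  stair.\<close>

definition stair_polynomial :: "nat \<Rightarrow> int poly" where
  "stair_polynomial d = (\<Sum>F | stair F. Polynomial.monom 1 (card F) * [:1, -1:] ^ (d - card F))"

lemma finite_stairs: "finite {F. stair F}"
  by (rule finite_subset[of _ "Pow V"]) (auto simp: stair_def finite_V)

lemma card_stair_le:
  assumes "stair F"
  shows "card F \<le> card (fst ` V) + card (snd ` V) - 1"
  using card_stair[OF assms] by (cases "F = {}") auto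

lemma hilbert_series_stairs:
  assumes "card (fst ` V) + card (snd ` V) \<le> d + 1"
  shows "Abs_fps (\<lambda>n. int (card (stair_monomials n))) * (1 - fps_X) ^ d = fps_of_poly (stair_polynomial d)"
proof -
  let ?G = "\<lambda>F. Abs_fps (\<lambda>n. int (support_count F n))"
  have "card (stair_monomials n) = (\<Sum>F | stair F. support_count F n)" for n
  proof -
    have "stair_monomials n = (\<Union>F\<in>{F. stair F}. {m. Poly_Mapping.keys m = F \<and> monomial_degree m = n})"
      by (auto simp: stair_monomials_def)
    then show ?thesis
      unfolding support_count_def
      by (simp only:) (rule card_UN_disjoint, auto intro: finite_stairs finite_support_monomials finite_stair)
  qed
  then have "Abs_fps (\<lambda>n. int (card (stair_monomials n))) = (\<Sum>F | stair F. ?G F)"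
    by (intro fps_ext) (simp add: fps_sum_nth)
  then have "Abs_fps (\<lambda>n. int (card (stair_monomials n))) * (1 - fps_X) ^ d =
      (\<Sum>F | stair F. ?G F * (1 - fps_X) ^ d)"
    by (simp add: sum_distrib_right)
  also have "\<dots> = (\<Sum>F | stair F. fps_of_poly (Polynomial.monom 1 (card F) * [:1, -1:] ^ (d - card F)))"
  proof (rule sum.cong)
    fix F assume F: "F \<in> {F. stair F}"
    then have "card F \<le> d" using card_stair_le[of F] assms by auto
    then have "?G F * (1 - fps_X) ^ d = ?G F * (1 - fps_X) ^ card F * (1 - fps_X) ^ (d - card F)"
      by (simp add: mult.assoc flip: power_add)
    also have "\<dots> = fps_X ^ card F * (1 - fps_X) ^ (d - card F)"
      using support_count_fps[OF finite_stair] F by simp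
    also have "\<dots> = fps_of_poly (Polynomial.monom 1 (card F) * [:1, -1:] ^ (d - card F))"
      by (simp add: fps_of_poly_mult fps_of_poly_monom fps_of_poly_power fps_of_poly_pCons)
    finally show "?G F * (1 - fps_X) ^ d = fps_of_poly (Polynomial.monom 1 (card F) * [:1, -1:] ^ (d - card F))" .
  qed simp
  also have "\<dots> = fps_of_poly (stair_polynomial d)"
    by (simp add: stair_polynomial_def fps_of_poly_sum)
  finally show ?thesis .
qed

text \<open>A stair with \<open>k\<close> vertices contributes a multiple of
  \<open>t\<^sup>k\<close>, so only the empty stair, the vertices and the pairs matter. Doubling
  avoids division; \<open>0 < d\<close> makes \<open>d - 1\<close> a true subtraction.\<close>

lemma coeff_stair_polynomial:
  assumes "0 < d"
  shows "2 * Polynomial.coeff (stair_polynomial d) 2 =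
    int d * (int d - 1) - 2 * int (card V) * (int d - 1) + 2 * int (card {F. stair F \<and> card F = 2})"
proof -
  let ?c = "\<lambda>k. 2 * Polynomial.coeff (Polynomial.monom 1 k * [:1, -1:] ^ (d - k) :: int poly) 2"
  have c: "?c k = (if k = 0 then int d * (int d - 1) else 0) + (if k = 1 then - 2 * (int d - 1) else 0)
      + (if k = 2 then 2 else 0)" for k
  proof -
    consider "k = 0" | "k = 1" | "k = 2" | "k > 2" by linarith
    then show ?thesis
    proof cases
      case 1
      then show ?thesis using coeff_one_minus_X_power(3)[of d] by (simp add: coeff_monom_mult)
    next
      case 2
      then show ?thesis
        using coeff_one_minus_X_power(2)[of "d - 1"] assms by (simp add: coeff_monom_mult of_nat_diff)
    next
      case 3
      then show ?thesis using coeff_one_minus_X_power(1)[of "d - 2"] by (simp add: coeff_monom_mult)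
    next
      case 4
      then show ?thesis by (simp add: coeff_monom_mult)
    qed
  qed
  have count: "(\<Sum>F | stair F. if card F = k then a else 0) = int (card {F. stair F \<and> card F = k}) * a" for k a
    using finite_stairs by (simp flip: sum.inter_filter)
  have "F = {}" if "stair F" "card F = 0" for F
    using that finite_stair[OF that(1)] by simp
  moreover have "stair {}" by (simp add: stair_def)
  ultimately have "{F. stair F \<and> card F = 0} = {{}}" by auto
  then have c0: "card {F. stair F \<and> card F = 0} = 1" by simp
  have "{F. stair F \<and> card F = 1} = (\<lambda>v. {v}) ` V"
    by (auto simp: card_1_singleton_iff stair_def crossing_def)
  then have c1: "card {F. stair F \<and> card F = 1} = card V" by (simp add: card_image)
  have "2 * Polynomial.coeff (stair_polynomial d) 2 = (\<Sum>F | stair F. ?c (card F))"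
    by (simp add: stair_polynomial_def coeff_sum sum_distrib_left)
  also have "\<dots> = int d * (int d - 1) - 2 * int (card V) * (int d - 1) + 2 * int (card {F. stair F \<and> card F = 2})"
    unfolding c sum.distrib count c0 c1 by (simp add: algebra_simps)
  finally show ?thesis .
qed

end

subsection \<open>The Krull dimension from below\<close>

lemma lookup_toric_eval:
  "Poly_Mapping.lookup (toric_eval F p) e =
     (\<Sum>m\<in>Poly_Mapping.keys p. if Poly_Mapping.keys m \<subseteq> F \<and> toric_exponent m = e
        then Poly_Mapping.lookup p m else 0)"
  unfolding toric_eval_def lookup_sum
  by (rule sum.cong) (auto simp: lookup_single when_def)

text \<open>Both diagonals of a rectangle use the same two columns and the same two rows.\<close>

lemma face_Int_Times: "face V (V \<inter> A \<times> B)"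
  unfolding face_def by auto

text \<open>Whether a monomial lies on a face \<open>A \<times> B\<close> is visible from its toric image.\<close>

lemma toric_eval_eq_0_mono:
  fixes p :: "'k::field mpolynomial"
  assumes p: "p \<in> carrier (polynomial_ring X)" and sub: "A' \<subseteq> A" "B' \<subseteq> B"
    and ev: "toric_eval (vertex_set X \<inter> A \<times> B) p = 0"
  shows "toric_eval (vertex_set X \<inter> A' \<times> B') p = 0"
proof (rule poly_mapping_eqI)
  fix e :: "int \<Rightarrow>\<^sub>0 nat"
  \<comment> \<open>\<open>Q\<close> says that \<open>e\<close> involves only columns in
    \<open>A'\<close> and rows in \<open>B'\<close>. Every coefficient on the smaller face is thus
    that on the larger face, or 0.\<close>
  define Q where "Q \<longleftrightarrow> (\<forall>a. 2 * a \<in> Poly_Mapping.keys e \<longrightarrow> a \<in> A') \<and>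
    (\<forall>b. 2 * b + 1 \<in> Poly_Mapping.keys e \<longrightarrow> b \<in> B')"
  have "Poly_Mapping.lookup (toric_eval (vertex_set X \<inter> A' \<times> B') p) e =
      (if Q then Poly_Mapping.lookup (toric_eval (vertex_set X \<inter> A \<times> B) p) e else 0)"
  proof -
    have iff: "(Poly_Mapping.keys m \<subseteq> vertex_set X \<inter> A' \<times> B' \<and> toric_exponent m = e) \<longleftrightarrow>
        Q \<and> (Poly_Mapping.keys m \<subseteq> vertex_set X \<inter> A \<times> B \<and> toric_exponent m = e)"
      if "m \<in> Poly_Mapping.keys p" for m
    proof (cases "toric_exponent m = e")
      case True
      have "Poly_Mapping.keys m \<subseteq> vertex_set X" using p that by (simp add: carrier_polynomial_ring)
      moreover have "Q \<longleftrightarrow> fst ` Poly_Mapping.keys m \<subseteq> A' \<and> snd ` Poly_Mapping.keys m \<subseteq> B'"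
        unfolding Q_def True[symmetric] toric_exponent_keys by blast
      moreover have "M \<subseteq> S \<times> T \<longleftrightarrow> fst ` M \<subseteq> S \<and> snd ` M \<subseteq> T"
        for M :: "(int \<times> int) set" and S T
        by (auto simp: subset_iff image_iff mem_Times_iff)
      ultimately show ?thesis using sub True by (simp add: le_inf_iff) blast
    qed simp
    have "Poly_Mapping.lookup (toric_eval (vertex_set X \<inter> A' \<times> B') p) e =
        (\<Sum>m\<in>Poly_Mapping.keys p. if Q \<and> (Poly_Mapping.keys m \<subseteq> vertex_set X \<inter> A \<times> B \<and> toric_exponent m = e)
          then Poly_Mapping.lookup p m else 0)"
      unfolding lookup_toric_eval by (rule sum.cong) (simp_all only: iff)
    then show ?thesis unfolding lookup_toric_eval by (cases Q) simp_all
  qed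
  then show "Poly_Mapping.lookup (toric_eval (vertex_set X \<inter> A' \<times> B') p) e = Poly_Mapping.lookup 0 e"
    by (simp add: ev)
qed

context ranked_tableau
begin

lemma full_row:
  obtains y where "\<And>x. x \<in> fst ` V \<Longrightarrow> (x, y) \<in> V"
proof -
  have *: "finite (\<rho> ` snd ` V)" "\<rho> ` snd ` V \<noteq> {}" using finite_V nonempty_V by auto
  obtain y where y: "y \<in> snd ` V" "\<rho> y = Max (\<rho> ` snd ` V)"
    using Max_in[OF *] by (metis (mono_tags, lifting) imageE)
  have "(x, y) \<in> V" if "(x, y') \<in> V" for x y'
  proof -
    have y': "y' \<in> snd ` V" using that by force
    then have "\<rho> y' \<le> \<rho> y" unfolding y(2) using * by (intro Max_ge) auto
    then show ?thesis using \<rho>_mono[OF that y(1)] inj_onD[OF inj_\<rho> _ y' y(1)] that by fastforce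
  qed
  then show ?thesis using that by force
qed

text \<open>Rows other than a full row \<open>y0\<close> are discarded one by one, then the columns.
  While rows go, all columns are present; while columns go, the full row still has a vertex in each.
  So every step loses a vertex, whose variable separates the two primes.\<close>

lemma prime_chain_exists:
  assumes X: "vertex_set X = V"
  shows "\<exists>P. prime_chain (coordinate_ring X :: 'k::field mpolynomial set ring)
    (card (fst ` V) + card (snd ` V) - 1) P"
proof -
  obtain y0 where y0: "\<And>x. x \<in> fst ` V \<Longrightarrow> (x, y0) \<in> V" using full_row by blast
  have "y0 \<in> snd ` V" using y0 nonempty_V by force
  obtain xs where xs: "set xs = fst ` V" "distinct xs"
    using finite_distinct_list[of "fst ` V"] finite_V by auto
  obtain ys where ys: "set ys = snd ` V - {y0}" "distinct ys"
    using finite_distinct_list[of "snd ` V - {y0}"] finite_V by auto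
  have len: "length xs = card (fst ` V)" "length ys = card (snd ` V) - 1"
    using distinct_card[OF xs(2)] distinct_card[OF ys(2)] xs ys \<open>y0 \<in> snd ` V\<close> finite_V by auto
  have pos: "card (snd ` V) > 0" using \<open>y0 \<in> snd ` V\<close> finite_V by (auto simp: card_gt_0_iff)
  \<comment> \<open>Truncated subtraction keeps all columns until the rows in \<open>ys\<close> are
    used up.\<close>
  define A where "A i = set (drop (i - length ys) xs)" for i
  define B where "B i = insert y0 (set (drop i ys))" for i
  define K where "K i = (toric_kernel X (vertex_set X \<inter> A i \<times> B i) :: 'k mpolynomial set)" for i
  define n where "n = card (fst ` V) + card (snd ` V) - 1"
  have n: "n = length ys + length xs" using len pos by (simp add: n_def)
  have sub: "A (Suc i) \<subseteq> A i" "B (Suc i) \<subseteq> B i" for i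
    using set_drop_subset_set_drop[of "i - length ys" "Suc i - length ys" xs]
      set_drop_subset_set_drop[of i "Suc i" ys] by (auto simp: A_def B_def)
  have witness: "\<exists>v. v \<in> V \<inter> A i \<times> B i \<and> v \<notin> A (Suc i) \<times> B (Suc i)" if i: "i < n" for i
  proof (cases "i < length ys")
    case True
    then have "ys ! i \<in> snd ` V" "ys ! i \<noteq> y0" using ys nth_mem by blast+
    then obtain x where x: "(x, ys ! i) \<in> V" by force
    then have "x \<in> fst ` V" by force
    then have "x \<in> A i" using True xs by (simp add: A_def)
    moreover have "ys ! i \<in> set (drop i ys)" using True by (metis Cons_nth_drop_Suc list.set_intros(1))
    moreover have "ys ! i \<notin> set (drop (Suc i) ys)"
      using True ys(2) by (metis Cons_nth_drop_Suc distinct.simps(2) distinct_drop)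
    ultimately show ?thesis using x \<open>ys ! i \<noteq> y0\<close> by (intro exI[of _ "(x, ys ! i)"]) (auto simp: B_def)
  next
    case False
    define j where "j = i - length ys"
    have j: "j < length xs" "i - length ys = j" "Suc i - length ys = Suc j" using i False n by (auto simp: j_def)
    have "(xs ! j, y0) \<in> V" using y0 xs j(1) nth_mem by blast
    moreover have "xs ! j \<in> set (drop j xs)" using j(1) by (metis Cons_nth_drop_Suc list.set_intros(1))
    moreover have "xs ! j \<notin> set (drop (Suc j) xs)"
      using j(1) xs(2) by (metis Cons_nth_drop_Suc distinct.simps(2) distinct_drop)
    ultimately show ?thesis by (intro exI[of _ "(xs ! j, y0)"]) (auto simp: A_def B_def j)
  qed
  have strict: "residue_class X ` K i \<subset> residue_class X ` K (Suc i)" if i: "i < n" for i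
  proof -
    obtain v where v: "v \<in> V \<inter> A i \<times> B i" "v \<notin> A (Suc i) \<times> B (Suc i)"
      using witness[OF i] by blast
    have var: "var v \<in> (carrier (polynomial_ring X) :: 'k mpolynomial set)" using v X by auto
    have mem: "residue_class X (var v :: 'k mpolynomial) \<in> residue_class X ` K j \<longleftrightarrow> v \<notin> A j \<times> B j" for j
      unfolding K_def residue_class_mem_toric_kernel_iff[OF face_Int_Times var] toric_eval_var
      using v(1) X by blast
    have "K i \<subseteq> K (Suc i)"
      using toric_eval_eq_0_mono[of _ X, OF _ sub[of i]] unfolding K_def toric_kernel_def by blast
    then show ?thesis using mem[of i] mem[of "Suc i"] v by blast
  qed
  have "primeideal (residue_class X ` K i) (coordinate_ring X)" for i
    unfolding K_def by (rule toric_kernel_image_prime[OF face_Int_Times])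
  then have "prime_chain (coordinate_ring X) n (\<lambda>i. residue_class X ` K i)"
    unfolding prime_chain_def using strict by blast
  then show ?thesis unfolding n_def by blast
qed

end


subsection \<open>The Krull dimension from above\<close>

text \<open>The lexicographically smallest term of an algebraic relation among the \<open>x\<^sub>i\<close> would put its
  coefficient into the last prime of the chain.\<close>

lemma no_algebraic_relation_along_prime_chain:
  fixes x :: "nat \<Rightarrow> 'a::comm_ring_1" and P :: "nat \<Rightarrow> 'a set"
  assumes C: "\<And>a b. a \<in> C \<Longrightarrow> b \<in> C \<Longrightarrow> a * b \<in> C" "\<And>a b. a \<in> C \<Longrightarrow> b \<in> C \<Longrightarrow> a + b \<in> C"
      "0 \<in> C" "1 \<in> C"
    and diff: "\<And>i a b. i \<le> k \<Longrightarrow> a \<in> P i \<Longrightarrow> b \<in> P i \<Longrightarrow> a - b \<in> P i"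
    and mult: "\<And>i a b. i \<le> k \<Longrightarrow> a \<in> P i \<Longrightarrow> b \<in> C \<Longrightarrow> a * b \<in> P i"
    and prime: "\<And>i a b. i \<le> k \<Longrightarrow> a \<in> C \<Longrightarrow> b \<in> C \<Longrightarrow> a * b \<in> P i \<Longrightarrow> a \<in> P i \<or> b \<in> P i"
    and chain: "\<And>i. i < k \<Longrightarrow> P i \<subseteq> P (Suc i)"
    and x: "\<And>i. i < k \<Longrightarrow> x i \<in> C \<and> x i \<in> P (Suc i) \<and> x i \<notin> P i"
    and c: "\<And>e. e \<in> E \<Longrightarrow> c e \<in> C \<and> c e \<notin> P k"
    and "j \<le> k" "finite E" "E \<noteq> {}"
    and "\<And>e e'. e \<in> E \<Longrightarrow> e' \<in> E \<Longrightarrow> (\<And>i. j \<le> i \<Longrightarrow> i < k \<Longrightarrow> e i = e' i) \<Longrightarrow> e = e'"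
  shows "(\<Sum>e\<in>E. c e * (\<Prod>i\<in>{j..<k}. x i ^ e i)) \<notin> P j"
  using assms(11) assms(10,12-)
proof (induction j arbitrary: E rule: inc_induct)
  case base
  \<comment> \<open>For \<open>j = k\<close> no exponent is left to tell elements of
    \<open>E\<close> apart.\<close>
  then obtain e where "E = {e}" by (metis atLeastLessThan_empty all_not_in_conv is_singletonI' is_singleton_def leD)
  then show ?case using base by simp
next
  case (step j)
  have pow: "a ^ n \<in> C" if "a \<in> C" for a n using that C by (induction n) auto
  have prodC: "(\<Prod>i\<in>I. x i ^ f i) \<in> C" if "I \<subseteq> {..<k}" for I and f :: "nat \<Rightarrow> nat"
    using that by (induction I rule: infinite_finite_induct) (use C x pow in auto)
  have sumC: "(\<Sum>e\<in>D. g e) \<in> C" if "\<And>e. e \<in> D \<Longrightarrow> g e \<in> C" for D :: "(nat \<Rightarrow> nat) set" and g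
    using that by (induction D rule: infinite_finite_induct) (use C in auto)
  have j: "j < k" using step.hyps by simp
  \<comment> \<open>\<open>a\<close> is the least exponent of \<open>x j\<close>, attained on
    \<open>D\<close>. After \<open>x j ^ a\<close> is factored out, the terms outside
    \<open>D\<close> lie in \<open>P (Suc j)\<close>, while the sum over \<open>D\<close> does not,
    by induction.\<close>
  define a where "a = Min ((\<lambda>e. e j) ` E)"
  define D where "D = {e \<in> E. e j = a}"
  let ?m = "\<lambda>e. c e * (\<Prod>i\<in>{Suc j..<k}. x i ^ e i)"
  let ?r = "\<Sum>e\<in>E - D. ?m e * x j ^ (e j - a - 1)"
  have a: "a \<le> e j" if "e \<in> E" for e unfolding a_def using that step.prems by auto
  have "a \<in> (\<lambda>e. e j) ` E" unfolding a_def using step.prems by (intro Min_in) auto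
  then have D: "D \<noteq> {}" "D \<subseteq> E" "finite D" using step.prems by (auto simp: D_def)
  have mC: "?m e \<in> C" if "e \<in> E" for e using that step.prems(1) by (intro C(1) prodC) auto
  have "(\<Sum>e\<in>D. ?m e) \<notin> P (Suc j)"
  proof (rule step.IH)
    show "e = e'" if "e \<in> D" "e' \<in> D" "\<And>i. Suc j \<le> i \<Longrightarrow> i < k \<Longrightarrow> e i = e' i" for e e'
    proof (rule step.prems(4))
      fix i assume "j \<le> i" "i < k"
      then show "e i = e' i" using that by (cases "i = j") (auto simp: D_def)
    qed (use that D in auto)
  qed (use D step.prems in auto)
  moreover have "x j * ?r \<in> P (Suc j)"
    using x[OF j] j mC pow C(1) by (intro mult sumC) auto
  ultimately have "(\<Sum>e\<in>D. ?m e) + x j * ?r \<notin> P (Suc j)"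
    using diff[of "Suc j" "(\<Sum>e\<in>D. ?m e) + x j * ?r" "x j * ?r"] j by auto
  then have notin: "(\<Sum>e\<in>D. ?m e) + x j * ?r \<notin> P j" using chain[OF j] by blast
  have factor: "c e * (\<Prod>i\<in>{j..<k}. x i ^ e i) = ?m e * x j ^ e j" for e
    using j by (subst prod.atLeast_Suc_lessThan) (auto simp: algebra_simps)
  have "(\<Sum>e\<in>E. c e * (\<Prod>i\<in>{j..<k}. x i ^ e i)) = (\<Sum>e\<in>D. ?m e * x j ^ e j) + (\<Sum>e\<in>E - D. ?m e * x j ^ e j)"
    unfolding factor by (rule trans[OF sum.subset_diff[OF D(2) step.prems(2)] add.commute])
  also have "(\<Sum>e\<in>D. ?m e * x j ^ e j) = x j ^ a * (\<Sum>e\<in>D. ?m e)"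
    unfolding sum_distrib_left by (rule sum.cong) (auto simp: D_def)
  also have "(\<Sum>e\<in>E - D. ?m e * x j ^ e j) = x j ^ a * (x j * ?r)"
    unfolding sum_distrib_left
  proof (rule sum.cong)
    fix e assume "e \<in> E - D"
    then have "a < e j" using a[of e] by (auto simp: D_def)
    then have "x j ^ e j = x j ^ a * (x j * x j ^ (e j - a - 1))"
      by (simp flip: power_Suc power_add)
    then show "?m e * x j ^ e j = x j ^ a * (x j * (?m e * x j ^ (e j - a - 1)))" by (simp add: mult_ac)
  qed simp
  finally have eq: "(\<Sum>e\<in>E. c e * (\<Prod>i\<in>{j..<k}. x i ^ e i)) = x j ^ a * ((\<Sum>e\<in>D. ?m e) + x j * ?r)"
    by (simp add: distrib_left)
  have sC: "(\<Sum>e\<in>D. ?m e) + x j * ?r \<in> C"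
  proof (rule C(2))
    show "(\<Sum>e\<in>D. ?m e) \<in> C" by (rule sumC) (use mC D(2) in blast)
    have "?r \<in> C" by (rule sumC) (use mC pow x[OF j] C(1) in blast)
    then show "x j * ?r \<in> C" using x[OF j] C(1) by blast
  qed
  \<comment> \<open>\<open>x j\<close> is outside the prime \<open>P j\<close>, so the power can be
    cancelled one factor at a time.\<close>
  have "x j ^ b * ((\<Sum>e\<in>D. ?m e) + x j * ?r) \<notin> P j" for b
  proof (induction b)
    case (Suc b)
    show ?case
    proof
      assume "x j ^ Suc b * ((\<Sum>e\<in>D. ?m e) + x j * ?r) \<in> P j"
      then have "x j * (x j ^ b * ((\<Sum>e\<in>D. ?m e) + x j * ?r)) \<in> P j" by (simp add: mult.assoc)
      then show False using prime[of j] Suc x[OF j] j pow C(1) sC by (meson less_imp_le)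
    qed
  qed (use notin in simp)
  then show ?case unfolding eq .
qed

text \<open>Bounding each exponent rather than the total degree makes the box embed into a function
  space, whose size is a plain power.\<close>

definition degree_box :: "(int \<times> int) set \<Rightarrow> nat \<Rightarrow> ((int \<times> int) \<Rightarrow>\<^sub>0 nat) set" where
  "degree_box V b = {m. Poly_Mapping.keys m \<subseteq> V \<and> (\<forall>v. Poly_Mapping.lookup m v \<le> b)}"

lemma card_degree_box:
  assumes "finite V"
  shows "finite (degree_box V b)" "card (degree_box V b) \<le> (b + 1) ^ card V"
proof -
  let ?f = "\<lambda>m. restrict (Poly_Mapping.lookup m) V"
  have inj: "inj_on ?f (degree_box V b)"
  proof (rule inj_onI)
    fix m m' assume m: "m \<in> degree_box V b" "m' \<in> degree_box V b" "?f m = ?f m'"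
    have "Poly_Mapping.lookup m v = Poly_Mapping.lookup m' v" for v
    proof (cases "v \<in> V")
      case True
      then show ?thesis using fun_cong[OF m(3), of v] by (simp only: restrict_apply if_True)
    next
      case False
      then have "v \<notin> Poly_Mapping.keys m" "v \<notin> Poly_Mapping.keys m'" using m(1,2) by (auto simp: degree_box_def)
      then show ?thesis by (simp add: in_keys_iff)
    qed
    then show "m = m'" by (rule poly_mapping_eqI)
  qed
  have sub: "?f ` degree_box V b \<subseteq> V \<rightarrow>\<^sub>E {..b}" by (auto simp: degree_box_def)
  have fin: "finite (V \<rightarrow>\<^sub>E {..b})" using assms by (intro finite_PiE) auto
  show "finite (degree_box V b)" by (rule inj_on_finite[OF inj sub fin])
  show "card (degree_box V b) \<le> (b + 1) ^ card V"
    using card_inj_on_le[OF inj sub fin] assms by (simp add: card_PiE)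
qed

lemma degree_box_mult:
  assumes "Poly_Mapping.keys p \<subseteq> degree_box V b" "Poly_Mapping.keys q \<subseteq> degree_box V b'"
  shows "Poly_Mapping.keys (p * q) \<subseteq> degree_box V (b + b')"
proof
  fix m assume "m \<in> Poly_Mapping.keys (p * q)"
  then obtain m1 m2 where m: "m = m1 + m2" "m1 \<in> Poly_Mapping.keys p" "m2 \<in> Poly_Mapping.keys q"
    using keys_mult[of p q] by blast
  then have "m1 \<in> degree_box V b" "m2 \<in> degree_box V b'" using assms by auto
  then show "m \<in> degree_box V (b + b')" unfolding m(1) degree_box_def by (auto simp: lookup_add add_mono)
qed

lemma degree_box_power:
  fixes p :: "'k::field mpolynomial"
  assumes "Poly_Mapping.keys p \<subseteq> degree_box V b"
  shows "Poly_Mapping.keys (p ^ n) \<subseteq> degree_box V (n * b)"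
proof (induction n)
  case 0
  then show ?case by (simp add: degree_box_def)
next
  case (Suc n)
  show ?case using degree_box_mult[OF assms Suc] by simp
qed

lemma degree_box_prod:
  fixes f :: "nat \<Rightarrow> 'k::field mpolynomial"
  assumes "finite I" "\<And>i. i \<in> I \<Longrightarrow> Poly_Mapping.keys (f i) \<subseteq> degree_box V b"
  shows "Poly_Mapping.keys (\<Prod>i\<in>I. f i) \<subseteq> degree_box V (card I * b)"
  using assms
proof (induction I rule: finite_induct)
  case empty
  then show ?case by (simp add: degree_box_def)
next
  case (insert i I)
  then show ?case using degree_box_mult[of "f i" V b "\<Prod>i\<in>I. f i" "card I * b"] by simp
qed

lemma degree_box_mono: "b \<le> b' \<Longrightarrow> degree_box V b \<subseteq> degree_box V b'"
  unfolding degree_box_def by (auto intro: order_trans)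

lemma degree_box_exists:
  fixes p :: "'k::field mpolynomial"
  assumes "\<And>m. m \<in> Poly_Mapping.keys p \<Longrightarrow> Poly_Mapping.keys m \<subseteq> V"
  shows "\<exists>b. Poly_Mapping.keys p \<subseteq> degree_box V b"
proof -
  let ?S = "\<Union>m\<in>Poly_Mapping.keys p. insert 0 (Poly_Mapping.lookup m ` Poly_Mapping.keys m)"
  have fin: "finite ?S" by simp
  have "Poly_Mapping.lookup m v \<le> Max ?S" if m: "m \<in> Poly_Mapping.keys p" for m v
  proof (cases "v \<in> Poly_Mapping.keys m")
    case True
    then show ?thesis using m by (intro Max_ge[OF fin]) blast
  next
    case False
    then show ?thesis by (simp add: in_keys_iff)
  qed
  then have "Poly_Mapping.keys p \<subseteq> degree_box V (Max ?S)" unfolding degree_box_def using assms by blast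
  then show ?thesis by blast
qed

lemma vector_space_mpolynomial: "vector_space (\<lambda>c (p :: 'k::field mpolynomial). const c * p)"
  by unfold_locales (auto simp: const_def single_add algebra_simps mult_single simp flip: mult.assoc)

text \<open>There are \<open>N\<^sup>k\<close> monomials with exponents below \<open>N\<close> in \<open>k\<close> polynomials, but these lie in a
  space of dimension \<open>O(N\<^sup>n)\<close>, where \<open>n = card V < k\<close>.\<close>

lemma algebraic_relation:
  fixes x :: "nat \<Rightarrow> 'k::field mpolynomial"
  assumes V: "finite V" "card V < k"
    and x: "\<forall>i<k. \<forall>m\<in>Poly_Mapping.keys (x i). Poly_Mapping.keys m \<subseteq> V"
  shows "\<exists>E c. finite E \<and> E \<noteq> {} \<and> (\<forall>e\<in>E. c e \<noteq> 0) \<and>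
    (\<forall>e\<in>E. \<forall>e'\<in>E. (\<forall>i<k. e i = e' i) \<longrightarrow> e = e') \<and>
    (\<Sum>e\<in>E. const (c e) * (\<Prod>i\<in>{0..<k}. x i ^ e i)) = 0"
proof -
  interpret vs: vector_space "\<lambda>c (p :: 'k mpolynomial). const c * p" by (rule vector_space_mpolynomial)
  have "\<exists>b. Poly_Mapping.keys (x i) \<subseteq> degree_box V b" if "i < k" for i
    using x that by (intro degree_box_exists) blast
  then obtain b where b: "\<And>i. i < k \<Longrightarrow> Poly_Mapping.keys (x i) \<subseteq> degree_box V (b i)" by metis
  define \<delta> where "\<delta> = Max (insert 0 (b ` {..<k}))"
  have \<delta>: "Poly_Mapping.keys (x i) \<subseteq> degree_box V \<delta>" if "i < k" for i
    using b[OF that] degree_box_mono[of "b i" \<delta> V] that by (auto simp: \<delta>_def)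
  \<comment> \<open>Large enough for
    \<open>(N * (k * \<delta> + 1)) ^ card V < N ^ (card V + 1)\<close>, and the right side is at
    most \<open>N ^ k\<close>.\<close>
  define N where "N = (k * \<delta> + 1) ^ card V + 1"
  define y where "y e = (\<Prod>i\<in>{0..<k}. x i ^ e i)" for e :: "nat \<Rightarrow> nat"
  define E where "E = {0..<k} \<rightarrow>\<^sub>E {..<N}"
  have finE: "finite E" and cardE: "card E = N ^ k" by (auto simp: E_def card_PiE intro: finite_PiE)
  have N: "1 \<le> N" by (simp add: N_def)
  have ext: "e = e'" if "e \<in> E" "e' \<in> E" "\<And>i. i < k \<Longrightarrow> e i = e' i" for e e'
    using that unfolding E_def by (intro PiE_ext[of e "{0..<k}" "\<lambda>_. {..<N}" e']) auto
  show ?thesis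
  proof (cases "inj_on y E")
    \<comment> \<open>Linear dependence speaks about sets, so coinciding power products are treated
      apart: their difference is already a relation.\<close>
    case False
    then obtain e e' where e: "e \<in> E" "e' \<in> E" "e \<noteq> e'" "y e = y e'" by (auto simp: inj_on_def)
    show ?thesis
      by (rule exI[of _ "{e, e'}"], rule exI[of _ "\<lambda>f. if f = e then 1 else - 1"])
         (use e ext in \<open>auto simp: const_def single_uminus simp flip: y_def\<close>)
  next
    case True
    let ?M = "degree_box V (k * (N * \<delta>))"
    let ?S = "(\<lambda>m. Poly_Mapping.single m (1 :: 'k)) ` ?M"
    have span: "y e \<in> vs.span ?S" if e: "e \<in> E" for e
    proof -
      have "Poly_Mapping.keys (x i ^ e i) \<subseteq> degree_box V (N * \<delta>)" if i: "i < k" for i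
      proof -
        have "e i \<le> N" using e i by (auto simp: E_def PiE_iff intro: less_imp_le)
        then show ?thesis
          using degree_box_power[OF \<delta>[OF i], of "e i"] degree_box_mono[of "e i * \<delta>" "N * \<delta>" V] by auto
      qed
      then have keys: "Poly_Mapping.keys (y e) \<subseteq> ?M"
        using degree_box_prod[of "{0..<k}" "\<lambda>i. x i ^ e i" V "N * \<delta>"] unfolding y_def by simp
      have "(\<Sum>m\<in>Poly_Mapping.keys (y e). const (Poly_Mapping.lookup (y e) m) * Poly_Mapping.single m 1) \<in> vs.span ?S"
        using keys by (intro vs.span_sum vs.span_scale vs.span_base) auto
      then show ?thesis
        by (simp add: const_def mult_single flip: poly_mapping_sum_single)
    qed
    have "card ?S \<le> card ?M" by (rule card_image_le) (rule card_degree_box[OF V(1)])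
    also have "\<dots> \<le> (k * (N * \<delta>) + 1) ^ card V" by (rule card_degree_box[OF V(1)])
    also have "\<dots> \<le> (N * (k * \<delta> + 1)) ^ card V"
      using N by (intro power_mono) (auto simp: algebra_simps)
    also have "\<dots> < N ^ card V * N"
    proof -
      have "(k * \<delta> + 1) ^ card V < N" by (simp add: N_def)
      then show ?thesis using N unfolding power_mult_distrib by (intro mult_strict_left_mono) auto
    qed
    also have "\<dots> = N ^ Suc (card V)" by simp
    also have "\<dots> \<le> N ^ k" using N V(2) by (intro power_increasing) auto
    also have "\<dots> = card (y ` E)" using card_image[OF True] cardE by simp
    finally have less: "card ?S < card (y ` E)" .
    have "finite ?S" using card_degree_box(1)[OF V(1)] by simp
    moreover have "y ` E \<subseteq> vs.span ?S" using span by blast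
    ultimately have "vs.dependent (y ` E)"
      using vs.independent_span_bound[of ?S "y ` E"] less leD by blast
    then obtain u where u: "\<exists>v\<in>y ` E. u v \<noteq> 0" "(\<Sum>v\<in>y ` E. const (u v) * v) = 0"
      using vs.dependent_finite[of "y ` E"] finE by auto
    let ?E = "{e \<in> E. u (y e) \<noteq> 0}"
    have "(\<Sum>e\<in>E. const (u (y e)) * y e) = 0"
      using u(2) by (simp add: sum.reindex[OF True])
    moreover have "(\<Sum>e\<in>E. const (u (y e)) * y e) = (\<Sum>e\<in>?E. const (u (y e)) * y e)"
      by (rule sum.mono_neutral_right) (use finE in \<open>auto simp: const_def\<close>)
    ultimately show ?thesis
      using u(1) finE ext by (intro exI[of _ ?E] exI[of _ "\<lambda>e. u (y e)"]) (auto simp flip: y_def)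
  qed
qed

text \<open>Pull the primes back to the polynomial ring and pick \<open>x i\<close> in the step from
  the \<open>i\<close>-th to the next. More than \<open>card (vertex_set X)\<close> polynomials
  satisfy an algebraic relation, which the chain forbids; its coefficients are units and thus avoid
  every prime.\<close>

lemma prime_chain_length_le:
  assumes fin: "finite (vertex_set X)"
    and chain: "prime_chain (coordinate_ring X :: 'k::field mpolynomial set ring) k P"
  shows "k \<le> card (vertex_set X)"
proof (rule ccontr)
  assume "\<not> k \<le> card (vertex_set X)"
  then have k: "card (vertex_set X) < k" by simp
  let ?R = "polynomial_ring X :: 'k mpolynomial ring"
  interpret hom: ring_hom_ring ?R "coordinate_ring X" "residue_class X" by (rule residue_class_hom)
  define Q where "Q i = {p \<in> carrier ?R. residue_class X p \<in> P i}" for i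
  have prime: "primeideal (Q i) ?R" if "i \<le> k" for i
    unfolding Q_def
    by (rule hom.primeideal_vimage[OF cring_polynomial_ring]) (use chain that in \<open>simp add: prime_chain_def\<close>)
  have QC: "Q i \<subseteq> carrier ?R" for i by (auto simp: Q_def)
  have Qneg: "- p \<in> Q i" if "i \<le> k" "p \<in> Q i" for i p
  proof -
    interpret primeideal "Q i" ?R by (rule prime[OF that(1)])
    show ?thesis using additive_subgroup.a_inv_closed[OF additive_subgroup_axioms that(2)]
        a_inv_polynomial_ring[of p X] QC that(2) by auto
  qed
  have Qadd: "p + q \<in> Q i" if "i \<le> k" "p \<in> Q i" "q \<in> Q i" for i p q
  proof -
    interpret primeideal "Q i" ?R by (rule prime[OF that(1)])
    show ?thesis using additive_subgroup.a_closed[OF additive_subgroup_axioms that(2,3)] by simp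
  qed
  have Qdiff: "p - q \<in> Q i" if "i \<le> k" "p \<in> Q i" "q \<in> Q i" for i p q
    using Qadd[OF that(1,2) Qneg[OF that(1,3)]] by simp
  have Qmult: "p * q \<in> Q i" if "i \<le> k" "p \<in> Q i" "q \<in> carrier ?R" for i p q
  proof -
    interpret primeideal "Q i" ?R by (rule prime[OF that(1)])
    show ?thesis using I_r_closed[OF that(2,3)] by simp
  qed
  have Qprime: "p \<in> Q i \<or> q \<in> Q i"
    if "i \<le> k" "p \<in> carrier ?R" "q \<in> carrier ?R" "p * q \<in> Q i" for i p q
  proof -
    interpret primeideal "Q i" ?R by (rule prime[OF that(1)])
    show ?thesis using I_prime[OF that(2,3)] that(4) by simp
  qed
  have "Q i \<noteq> carrier ?R" if "i \<le> k" for i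
    using primeideal.I_notcarr[OF prime[OF that]] by blast
  then have Q1: "1 \<notin> Q i" if "i \<le> k" for i
    using Qmult[OF that, of 1] QC[of i] that by (metis mult_1 subsetI subset_antisym)
  have const: "const c \<notin> Q i" if "i \<le> k" "c \<noteq> 0" for i c
  proof
    assume "const c \<in> Q i"
    then have "const c * const (inverse c) \<in> Q i" using Qmult[OF that(1)] by blast
    moreover have "const c * const (inverse c) = 1" using that(2) by (simp add: const_def mult_single)
    ultimately show False using Q1[OF that(1)] by simp
  qed
  have "\<exists>p. p \<in> Q (Suc i) \<and> p \<notin> Q i" if i: "i < k" for i
  proof -
    have "P i \<subset> P (Suc i)" "primeideal (P (Suc i)) (coordinate_ring X)"
      using chain i by (auto simp: prime_chain_def)
    then obtain a where a: "a \<in> P (Suc i)" "a \<notin> P i" "a \<in> carrier (coordinate_ring X)"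
      by (meson ideal.Icarr primeideal.axioms(1) psubsetE subsetI)
    then obtain p where "p \<in> carrier ?R" "a = residue_class X p" unfolding carrier_coordinate_ring by auto
    then show ?thesis using a by (auto simp: Q_def)
  qed
  then obtain x where x: "\<And>i. i < k \<Longrightarrow> x i \<in> Q (Suc i) \<and> x i \<notin> Q i" by metis
  have xC: "x i \<in> carrier ?R" if "i < k" for i using x[OF that] QC by auto
  then have "\<forall>i<k. \<forall>m\<in>Poly_Mapping.keys (x i). Poly_Mapping.keys m \<subseteq> vertex_set X"
    unfolding carrier_polynomial_ring by blast
  from algebraic_relation[OF fin k this]
  obtain E c where E: "finite E" "E \<noteq> {}" "\<forall>e\<in>E. c e \<noteq> 0"
    "\<forall>e\<in>E. \<forall>e'\<in>E. (\<forall>i<k. e i = e' i) \<longrightarrow> e = e'"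
    "(\<Sum>e\<in>E. const (c e) * (\<Prod>i\<in>{0..<k}. x i ^ e i)) = 0"
    by (elim exE conjE) (rule that)
  have chainQ: "Q i \<subseteq> Q (Suc i)" if "i < k" for i
    using chain that by (auto simp: prime_chain_def Q_def)
  have "(\<Sum>e\<in>E. const (c e) * (\<Prod>i\<in>{0..<k}. x i ^ e i)) \<notin> Q 0"
    by (rule no_algebraic_relation_along_prime_chain[where C = "carrier ?R"])
       (use Qdiff Qmult Qprime chainQ x xC const E in auto)
  moreover have "0 \<in> Q 0"
    using additive_subgroup.zero_closed[OF ideal.axioms(1)[OF primeideal.axioms(1)[OF prime[of 0]]]] by simp
  ultimately show False using E(5) by simp
qed

text \<open>The upper bound also shows that the dimension is finite, so \<open>the_enat\<close> in
  \<open>h_polynomial_of\<close> returns its actual value.\<close>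

lemma (in ranked_tableau) krull_dim_bounds:
  assumes X: "vertex_set X = V"
  obtains d where "krull_dim (coordinate_ring X :: 'k::field mpolynomial set ring) = enat d"
    "card (fst ` V) + card (snd ` V) \<le> d + 1" "d \<le> card V"
proof -
  let ?A = "coordinate_ring X :: 'k mpolynomial set ring"
  let ?S = "{enat n | n. \<exists>P. prime_chain ?A n P}"
  have "krull_dim ?A \<le> enat (card V)"
    unfolding krull_dim_def
    by (rule Sup_least) (use prime_chain_length_le[of X] X finite_V in auto)
  then obtain d where d: "krull_dim ?A = enat d" "d \<le> card V"
    by (metis enat_ile enat_ord_simps(1))
  have "enat (card (fst ` V) + card (snd ` V) - 1) \<le> krull_dim ?A"
    unfolding krull_dim_def by (rule Sup_upper) (use prime_chain_exists[OF X] in auto)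
  then show ?thesis using that[OF d(1) _ d(2)] d(1) by auto
qed

subsection \<open>The coefficients in degree two\<close>

text \<open>The sum in \<open>rook_polynomial\<close> stops at the number of cells, so index 2 must
  be within range.\<close>

lemma coeff_rook_polynomial_2:
  assumes "2 \<le> card (cells X)"
  shows "Polynomial.coeff (rook_polynomial X) 2 = int (card (rook_configurations X 2))"
  using assms by (simp add: rook_polynomial_def coeff_sum)

lemma rook_configurations_2:
  assumes "finite (cells X)"
  shows "rook_configurations X 2 = rook_pairs (cells X)"
  unfolding rook_configurations_def rook_pairs_def using assms by (auto dest: finite_subset)

lemma (in ranked_tableau) h_polynomial_eq:
  assumes X: "vertex_set X = V"
    and d: "krull_dim (coordinate_ring X :: 'k::field mpolynomial set ring) = enat d"
      "card (fst ` V) + card (snd ` V) \<le> d + 1"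
  shows "h_polynomial TYPE('k) X = stair_polynomial d"
  unfolding h_polynomial_def h_polynomial_of_def hilbert_series_def dim_graded_piece[OF X] d(1) the_enat.simps
    hilbert_series_stairs[OF d(2)]
  by (rule the_equality) auto

lemma ranked_tableau_exists:
  assumes fin: "finite V" and ne: "V \<noteq> {}"
    and ex: "\<forall>x y x' y'. (x, y) \<in> V \<longrightarrow> (x', y') \<in> V \<longrightarrow> (x, y') \<in> V \<or> (x', y) \<in> V"
  shows "\<exists>\<gamma> \<rho>. ranked_tableau V \<gamma> \<rho>"
proof -
  obtain \<rho> :: "int \<Rightarrow> nat" where \<rho>: "inj_on \<rho> (snd ` V)"
    "\<forall>x y y'. (x, y) \<in> V \<longrightarrow> y' \<in> snd ` V \<longrightarrow> \<rho> y < \<rho> y' \<longrightarrow> (x, y') \<in> V"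
    using exchange_rank[OF fin ex] by blast
  \<comment> \<open>The exchange property is symmetric in the coordinates; the transposed set yields
    the ranks of the columns.\<close>
  let ?W = "prod.swap ` V"
  have swap: "(y, x) \<in> ?W \<longleftrightarrow> (x, y) \<in> V" for x y by force
  have W: "finite ?W" "snd ` ?W = fst ` V"
    using fin by (auto simp: image_image)
  have exW: "\<forall>x y x' y'. (x, y) \<in> ?W \<longrightarrow> (x', y') \<in> ?W \<longrightarrow> (x, y') \<in> ?W \<or> (x', y) \<in> ?W"
    using ex unfolding swap by blast
  obtain \<gamma> :: "int \<Rightarrow> nat" where \<gamma>: "inj_on \<gamma> (snd ` ?W)"
    "\<forall>x y y'. (x, y) \<in> ?W \<longrightarrow> y' \<in> snd ` ?W \<longrightarrow> \<gamma> y < \<gamma> y' \<longrightarrow> (x, y') \<in> ?W"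
    using exchange_rank[OF W(1) exW] by blast
  have "ranked_tableau V \<gamma> \<rho>"
  proof
    show "(x', y) \<in> V" if "(x, y) \<in> V" "x' \<in> fst ` V" "\<gamma> x < \<gamma> x'" for x y x'
      using \<gamma>(2) that unfolding W(2) swap by blast
    show "(x, y') \<in> V" if "(x, y) \<in> V" "y' \<in> snd ` V" "\<rho> y < \<rho> y'" for x y y'
      using \<rho>(2) that by blast
  qed (use fin ne \<rho>(1) \<gamma>(1) W(2) in simp_all)
  then show ?thesis by blast
qed

theorem corollary3p4:
  fixes X :: "(real \<times> real) set"
  assumes "L_convex X"
    and "\<not> thin X"
  shows "Polynomial.coeff (h_polynomial TYPE('k::field) X) 2
       < Polynomial.coeff (rook_polynomial X) 2"
proof -
  define S where "S = cells X"
  define V where "V = vertex_set X"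
  obtain a b where square: "{(a, b), (a + 1, b), (a, b + 1), (a + 1, b + 1)} \<subseteq> S"
    using assms(2) unfolding thin_def S_def by blast
  then have "cells X \<noteq> {}" by (auto simp: S_def)
  note discrete = L_convex_discrete[OF assms(1) this]
  interpret S: L_convex_cells S unfolding S_def by (rule discrete(1))
  have V: "V = corners S" unfolding V_def S_def by (rule discrete(2))
  have finV: "finite V" unfolding V by (rule finite_corners[OF S.finite_S])
  have neV: "V \<noteq> {}" using square unfolding V by (auto simp: corners_def)
  have "\<forall>x y x' y'. (x, y) \<in> V \<longrightarrow> (x', y') \<in> V \<longrightarrow> (x, y') \<in> V \<or> (x', y) \<in> V"
    using exchange_corners[of S] S.exchange unfolding V by blast
  then obtain \<gamma> \<rho> where "ranked_tableau V \<gamma> \<rho>"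
    using ranked_tableau_exists[OF finV neV] by blast
  then interpret ranked_tableau V \<gamma> \<rho> .
  have X: "vertex_set X = V" by (simp add: V_def)
  obtain d where d: "krull_dim (coordinate_ring X :: 'k mpolynomial set ring) = enat d"
    "card (fst ` V) + card (snd ` V) \<le> d + 1" "d \<le> card V"
    using krull_dim_bounds[OF X] .
  have "card (fst ` V) > 0" "card (snd ` V) > 0"
    using finV neV by (auto simp: card_gt_0_iff)
  then have "0 < d" using d(2) by linarith
  \<comment> \<open>From here on all inequalities are doubled and over the integers, to avoid
    division and truncated subtraction.\<close>
  define n c r r2 f2 e where "n = int (card V)" and "c = int (card S)"
    and "r = int (card (rectangles V))" and "r2 = int (card (rook_pairs S))"
    and "f2 = int (card {F. stair F \<and> card F = 2})" and "e = n - int d"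
  have choose: "2 * int (m choose 2) = int m * (int m - 1)" for m :: nat
  proof -
    have "even (m * (m - 1))" by (cases m) auto
    then have "2 * (m choose 2) = m * (m - 1)" by (simp add: choose_two)
    then have "int (2 * (m choose 2)) = int (m * (m - 1))" by presburger
    then show ?thesis by (cases m) (auto simp: algebra_simps)
  qed
  have h: "2 * Polynomial.coeff (h_polynomial TYPE('k) X) 2 = int d * (int d - 1) - 2 * n * (int d - 1) + 2 * f2"
    using coeff_stair_polynomial[OF \<open>0 < d\<close>] unfolding h_polynomial_eq[OF X d(1,2)] n_def f2_def .
  have crossings: "2 * f2 + 2 * r \<le> n * (n - 1)"
    using stair_pairs_plus_rectangles choose[of "card V"] unfolding f2_def r_def n_def by linarith
  have rooks: "c * (c - 1) + 2 * c < 2 * r2 + 2 * r"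
    using choose_two_less_rook_pairs_plus_rectangles[OF S.finite_S square] choose[of "card S"]
    unfolding c_def r2_def r_def V by linarith
  \<comment> \<open>Nonnegativity of \<open>e\<close> is what allows \<open>e \<le> c\<close> to be
    squared.\<close>
  have "0 \<le> e" using d(3) by (simp add: e_def n_def)
  moreover have "e \<le> c"
    using S.card_corners_le d(2) unfolding V[symmetric] e_def n_def c_def by linarith
  ultimately have "e * e \<le> c * c" by (intro mult_mono) auto
  have "2 * Polynomial.coeff (h_polynomial TYPE('k) X) 2 \<le>
      int d * (int d - 1) - 2 * n * (int d - 1) + n * (n - 1) - 2 * r"
    using h crossings by linarith
  \<comment> \<open>Substituting \<open>d = n - e\<close> removes \<open>n\<close>;
    \<open>e * e + e\<close> is twice \<open>e + 1 choose 2\<close>.\<close>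
  also have "\<dots> = e * e + e - 2 * r" unfolding e_def by (simp add: algebra_simps)
  also have "\<dots> \<le> c * c + c - 2 * r" using \<open>e * e \<le> c * c\<close> \<open>e \<le> c\<close> by linarith
  also have "\<dots> = c * (c - 1) + 2 * c - 2 * r" by (simp add: algebra_simps)
  also have "\<dots> < 2 * r2" using rooks by linarith
  finally have "Polynomial.coeff (h_polynomial TYPE('k) X) 2 < r2" by simp
  moreover have "card {(a, b), (a + 1, b)} \<le> card S"
    by (rule card_mono) (use square S.finite_S in auto)
  then have "Polynomial.coeff (rook_polynomial X) 2 = r2"
    using coeff_rook_polynomial_2[of X] rook_configurations_2[of X] S.finite_S
    unfolding r2_def S_def by simp
  ultimately show ?thesis by simp
qed

end
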